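(* Let $\mathbb{R}^2$ be endowed with a smooth complete Riemannian metric given in polar coordinates $(\theta,r)$ by \[ g=dr^2+\phi(\theta,r)^2\,d\theta^2 . \] Let $p\ge 2$ and assume that, outside a compact subset, the Gaussian curvature $K$ of $g$ satisfies either (i) $\displaystyle K\ge-\frac{p-1}{r^2\log r}$, or (ii) $\displaystyle K\ge-\frac{(p-1)(p-2)}{r^2}$. Then every $p$-subharmonic function $u\in C^1(\mathbb{R}^2)$ satisfying \[ \liminf_{r\to\infty}\frac{M(u,r)}{\log\log r}=0 \] is constant.
   Context: Here $r$ is the distance to the origin (a pole of $g$), $\theta\in\mathbb{S}^1$, and $\phi(\theta,r)>0$ for $r>0$. Notation: $M(u,r)=\sup_{\theta\in\mathbb{S}^1}|u(\theta,r)|$. The $p$-Laplacian of $g$ is $\Delta_p u=\operatorname{div}(|\nabla u|^{p-2}\nabla u)$, with gradient, norm and divergence taken with respect to $g$. A function $u\in C^1(\mathbb{R}^2)$ is $p$-subharmonic if $\Delta_p u\ge0$ in the weak sense, i.e. $\int_{\mathbb{R}^2}|\nabla u|^{p-2}\langle\nabla u,\nabla\eta\rangle\,dV_g\le 0$ for every nonnegative $\eta\in C_c^\infty(\mathbb{R}^2)$. *)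

theory Defs
  imports "HOL-Analysis.Analysis"
begin

primrec C_k :: "nat \<Rightarrow> ('a::euclidean_space \<Rightarrow> 'b::real_normed_vector) \<Rightarrow> bool" where
  "C_k 0 f \<longleftrightarrow> continuous_on UNIV f"
| "C_k (Suc k) f \<longleftrightarrow>
     (\<forall>x. f differentiable (at x)) \<and>
     (\<forall>b\<in>Basis. C_k k (\<lambda>x. frechet_derivative f (at x) b))"

definition smooth :: "('a::euclidean_space \<Rightarrow> 'b::real_normed_vector) \<Rightarrow> bool" where
  "smooth f \<longleftrightarrow> (\<forall>k. C_k k f)"

definition partial :: "'n::finite \<Rightarrow> (real^'n \<Rightarrow> real) \<Rightarrow> real^'n \<Rightarrow> real" where
  "partial i f x = frechet_derivative f (at x) (axis i 1)"

text \<open>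
  A metric tensor on \<open>\<real>\<^sup>2\<close>, or on a coordinate patch, is given by its matrix of
  coefficients at each point.
\<close>

type_synonym metric_field = "real^2 \<Rightarrow> real^2^2"

definition riemannian_metric :: "metric_field \<Rightarrow> bool" where
  "riemannian_metric g \<longleftrightarrow>
     smooth g \<and> (\<forall>x. transpose (g x) = g x \<and> (\<forall>v. v \<noteq> 0 \<longrightarrow> v \<bullet> (g x *v v) > 0))"

definition riem_inner :: "metric_field \<Rightarrow> real^2 \<Rightarrow> real^2 \<Rightarrow> real^2 \<Rightarrow> real" where
  "riem_inner g x v w = v \<bullet> (g x *v w)"

definition riem_norm :: "metric_field \<Rightarrow> real^2 \<Rightarrow> real^2 \<Rightarrow> real" where
  "riem_norm g x v = sqrt (riem_inner g x v v)"

definition riem_volume :: "metric_field \<Rightarrow> (real^2) measure" where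
  "riem_volume g = density lborel (\<lambda>x. ennreal (sqrt (det (g x))))"

definition riem_grad :: "metric_field \<Rightarrow> (real^2 \<Rightarrow> real) \<Rightarrow> real^2 \<Rightarrow> real^2" where
  "riem_grad g u x = matrix_inv (g x) *v (\<chi> i. partial i u x)"

definition riem_length :: "metric_field \<Rightarrow> (real \<Rightarrow> real^2) \<Rightarrow> real" where
  "riem_length g c = integral {0..1} (\<lambda>t. riem_norm g (c t) (vector_derivative c (at t)))"

text \<open>
  The infimum is taken over \<open>C\<^sup>1\<close> curves rather than over the library's piecewise
  \<open>C\<^sup>1\<close> paths: the latter may have unbounded, non-integrable speed near a breakpoint,
  and the integral above would then be the dummy value 0.
\<close>

definition riem_dist :: "metric_field \<Rightarrow> real^2 \<Rightarrow> real^2 \<Rightarrow> real" where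
  "riem_dist g x y =
     Inf {riem_length g c | c. c C1_differentiable_on {0..1} \<and> c 0 = x \<and> c 1 = y}"

definition complete_riemannian_metric :: "metric_field \<Rightarrow> bool" where
  "complete_riemannian_metric g \<longleftrightarrow>
     riemannian_metric g \<and> Metric_space.mcomplete UNIV (riem_dist g)"

definition christoffel :: "metric_field \<Rightarrow> 2 \<Rightarrow> 2 \<Rightarrow> 2 \<Rightarrow> real^2 \<Rightarrow> real" where
  "christoffel h k i j y =
     (\<Sum>l\<in>UNIV. matrix_inv (h y) $ k $ l *
        (partial i (\<lambda>z. h z $ j $ l) y + partial j (\<lambda>z. h z $ i $ l) y
          - partial l (\<lambda>z. h z $ i $ j) y)) / 2"

text \<open>
  The index convention is \<open>R(\<partial>\<^sub>i, \<partial>\<^sub>j) \<partial>\<^sub>k = \<Sum>\<^sub>l (riem_curv h l k i j) \<partial>\<^sub>l\<close>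
  with \<open>R(X, Y) = [\<nabla>\<^sub>X, \<nabla>\<^sub>Y] - \<nabla>\<^bsub>[X, Y]\<^esub>\<close>, so that
  \<open>\<langle>R(\<partial>\<^sub>1, \<partial>\<^sub>2) \<partial>\<^sub>2, \<partial>\<^sub>1\<rangle> / det h\<close> is the Gaussian curvature.
\<close>

definition riem_curv :: "metric_field \<Rightarrow> 2 \<Rightarrow> 2 \<Rightarrow> 2 \<Rightarrow> 2 \<Rightarrow> real^2 \<Rightarrow> real" where
  "riem_curv h l k i j y =
     partial i (christoffel h l j k) y - partial j (christoffel h l i k) y
     + (\<Sum>m\<in>UNIV. christoffel h l i m y * christoffel h m j k y
                   - christoffel h l j m y * christoffel h m i k y)"

definition gauss_curvature :: "metric_field \<Rightarrow> real^2 \<Rightarrow> real" where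
  "gauss_curvature h y = (\<Sum>l\<in>UNIV. h y $ 1 $ l * riem_curv h l 2 1 2 y) / det (h y)"

text \<open>
  Polar coordinates \<open>(\<theta>, r)\<close>, in this order, are the components 1 and 2 of a vector.
\<close>

definition polar :: "real^2 \<Rightarrow> real^2" where
  "polar y = vector [y $ 2 * cos (y $ 1), y $ 2 * sin (y $ 1)]"

definition pullback_metric :: "(real^2 \<Rightarrow> real^2) \<Rightarrow> metric_field \<Rightarrow> metric_field" where
  "pullback_metric P g y =
     transpose (jacobian P (at y)) ** g (P y) ** jacobian P (at y)"

text \<open>The coefficients of \<open>dr\<^sup>2 + \<phi>(\<theta>, r)\<^sup>2 d\<theta>\<^sup>2\<close> in the coordinates \<open>(\<theta>, r)\<close>.\<close>

definition polar_metric :: "(real \<Rightarrow> real \<Rightarrow> real) \<Rightarrow> metric_field" where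
  "polar_metric \<phi> y = vector [vector [(\<phi> (y $ 1) (y $ 2))\<^sup>2, 0], vector [0, 1]]"

definition has_polar_form :: "metric_field \<Rightarrow> (real \<Rightarrow> real \<Rightarrow> real) \<Rightarrow> bool" where
  "has_polar_form g \<phi> \<longleftrightarrow>
     (\<forall>\<theta> r. r > 0 \<longrightarrow> pullback_metric polar g (vector [\<theta>, r]) = polar_metric \<phi> (vector [\<theta>, r]))"

text \<open>
  The Gaussian curvature of \<open>g\<close> at the point with polar coordinates \<open>(\<theta>, r)\<close>,
  \<open>r > 0\<close>. It does not depend on the chart; it is evaluated in the polar one.
\<close>

definition polar_curvature :: "metric_field \<Rightarrow> real \<Rightarrow> real \<Rightarrow> real" where
  "polar_curvature g \<theta> r = gauss_curvature (pullback_metric polar g) (vector [\<theta>, r])"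

text \<open>
  The convention \<open>0 powr 0 = 0\<close> is harmless for \<open>p = 2\<close>: where the gradient of \<open>u\<close>
  vanishes, so does the second factor.
\<close>

definition p_subharmonic :: "metric_field \<Rightarrow> real \<Rightarrow> (real^2 \<Rightarrow> real) \<Rightarrow> bool" where
  "p_subharmonic g p u \<longleftrightarrow>
     (\<forall>\<eta>. smooth \<eta> \<and> compact (closure {x. \<eta> x \<noteq> 0}) \<and> (\<forall>x. \<eta> x \<ge> 0) \<longrightarrow>
        (\<integral>x. riem_norm g x (riem_grad g u x) powr (p - 2) *
              riem_inner g x (riem_grad g u x) (riem_grad g \<eta> x) \<partial>riem_volume g) \<le> 0)"

definition max_modulus :: "(real^2 \<Rightarrow> real) \<Rightarrow> real \<Rightarrow> real" where
  "max_modulus u r = (SUP \<theta>. \<bar>u (polar (vector [\<theta>, r]))\<bar>)"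

end

theory Submission
  imports Defs
begin

text \<open>
  Only the log-derivative \<open>\<psi> = \<phi>\<^sub>r / \<phi>\<close> of the metric matters; it solves the Riccati equation
  \<open>\<psi>\<^sub>r = - K - \<psi>\<^sup>2\<close>. Put \<open>s = (r log r)\<^sup>p\<^sup>-\<^sup>1\<close> and \<open>h = s' / s\<close>. Then \<open>r\<^sup>2 (h' + h\<^sup>2)\<close>
  dominates both \<open>(p - 1) / log r\<close> and \<open>(p - 1) (p - 2)\<close>, so Riccati comparison gives
  \<open>\<psi> \<le> h + C / r\<^sup>2\<close> under either hypothesis. Hence a radial \<open>f\<close> with
  \<open>f'\<^sup>p\<^sup>-\<^sup>1 = exp (C / r) / s\<close> is \<open>p\<close>-superharmonic and grows at least like \<open>log log r\<close>.

  Fix a ball \<open>B\<close>, let \<open>f\<close> vanish on \<open>B\<close> (switching it on smoothly costs a bounded error), and let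
  \<open>c < u\<close> on \<open>B\<close>. By the growth hypothesis, for every \<open>\<tau> > 0\<close> there is a circle on which
  \<open>u - c - \<tau> f < 0\<close>. Testing the weak inequality with the square of the positive part of
  \<open>u - c - \<tau> f\<close> inside this circle, and using the monotonicity of the \<open>p\<close>-Laplacian, bounds
  \<open>\<integral>\<^sub>B (u - c) |\<nabla>u|\<^sup>p\<close> by a constant times \<open>\<tau>\<^sup>p\<^sup>-\<^sup>1\<close>. Letting \<open>\<tau> \<rightarrow> 0\<close> shows \<open>\<nabla>u = 0\<close> on \<open>B\<close>.
\<close>

section \<open>Calculus of \<open>C\<^sup>k\<close> functions\<close>

lemma C_k_Suc_imp: "C_k (Suc k) f \<Longrightarrow> C_k k f"
proof (induction k arbitrary: f)
  case 0
  then show ?case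
    by (auto intro!: differentiable_imp_continuous_on simp: differentiable_on_def
        intro: differentiable_at_withinI)
next
  case (Suc k)
  from Suc.prems have "\<And>b. b \<in> Basis \<Longrightarrow> C_k (Suc k) (\<lambda>x. frechet_derivative f (at x) b)"
    by simp
  with Suc show ?case by (auto simp del: C_k.simps(2) simp: C_k.simps(2)[of k f] C_k.simps(2)[of "Suc k" f])
qed

lemma C_k_const: "C_k k (\<lambda>x. c)"
  by (induction k arbitrary: c) auto

lemma C_k_SucI:
  assumes "\<And>x. (f has_derivative f' x) (at x)" "\<And>b. b \<in> Basis \<Longrightarrow> C_k k (\<lambda>x. f' x b)"
  shows "C_k (Suc k) f"
proof -
  have "frechet_derivative f (at x) = f' x" for x
    using frechet_derivative_at[OF assms(1)] by metis
  then show ?thesis using assms by (auto simp: differentiable_def)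
qed

lemma C_k_SucD:
  assumes "C_k (Suc k) f"
  obtains f' where "\<And>x. (f has_derivative f' x) (at x)" "\<And>b. b \<in> Basis \<Longrightarrow> C_k k (\<lambda>x. f' x b)"
  using assms that[of "\<lambda>x. frechet_derivative f (at x)"] frechet_derivative_works by auto

lemma C_k_add:
  assumes "C_k k f" "C_k k g"
  shows "C_k k (\<lambda>x. f x + g x)"
  using assms
proof (induction k arbitrary: f g)
  case (Suc k)
  obtain f' where f': "\<And>x. (f has_derivative f' x) (at x)" "\<And>b. b \<in> Basis \<Longrightarrow> C_k k (\<lambda>x. f' x b)"
    using C_k_SucD[OF Suc.prems(1)] by blast
  obtain g' where g': "\<And>x. (g has_derivative g' x) (at x)" "\<And>b. b \<in> Basis \<Longrightarrow> C_k k (\<lambda>x. g' x b)"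
    using C_k_SucD[OF Suc.prems(2)] by blast
  show ?case
    by (rule C_k_SucI[OF has_derivative_add[OF f'(1) g'(1)]]) (simp add: Suc.IH f' g')
qed (auto intro: continuous_intros)

lemma C_k_bounded_linear:
  assumes "bounded_linear L" "C_k k f"
  shows "C_k k (\<lambda>x. L (f x))"
  using assms(2)
proof (induction k arbitrary: f)
  case 0
  then show ?case using bounded_linear.continuous_on[OF assms(1)] by auto
next
  case (Suc k)
  obtain f' where f': "\<And>x. (f has_derivative f' x) (at x)" "\<And>b. b \<in> Basis \<Longrightarrow> C_k k (\<lambda>x. f' x b)"
    using C_k_SucD[OF Suc.prems] by blast
  show ?case
    by (rule C_k_SucI[OF bounded_linear.has_derivative[OF assms(1) f'(1)]]) (simp add: Suc.IH f')
qed

lemma C_k_mult: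
  fixes f g :: "'a::euclidean_space \<Rightarrow> real"
  assumes "C_k k f" "C_k k g"
  shows "C_k k (\<lambda>x. f x * g x)"
  using assms
proof (induction k arbitrary: f g)
  case (Suc k)
  obtain f' where f': "\<And>x. (f has_derivative f' x) (at x)" "\<And>b. b \<in> Basis \<Longrightarrow> C_k k (\<lambda>x. f' x b)"
    using C_k_SucD[OF Suc.prems(1)] by blast
  obtain g' where g': "\<And>x. (g has_derivative g' x) (at x)" "\<And>b. b \<in> Basis \<Longrightarrow> C_k k (\<lambda>x. g' x b)"
    using C_k_SucD[OF Suc.prems(2)] by blast
  note C_k_Suc_imp[OF Suc.prems(1)] C_k_Suc_imp[OF Suc.prems(2)]
  then show ?case
    by (intro C_k_SucI[OF has_derivative_mult[OF f'(1) g'(1)]] C_k_add Suc.IH f' g') auto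
qed (auto intro: continuous_intros)

lemma C_k_diff:
  assumes "C_k k f" "C_k k g"
  shows "C_k k (\<lambda>x. f x - g x)"
  using C_k_add[OF assms(1) C_k_bounded_linear[OF bounded_linear_minus[OF bounded_linear_ident] assms(2)]]
  by simp

lemma C_k_ident: "C_k k (\<lambda>x. x)"
proof (cases k)
  case (Suc n)
  then show ?thesis using C_k_SucI[OF has_derivative_ident] C_k_const by metis
qed auto

text \<open>Collects the partial derivatives into one gradient vector, so that all later derivatives
  can be written as inner products \<open>h \<bullet> df x\<close>.\<close>

lemma C_k_gradient:
  assumes "C_k (Suc k) f"
  obtains df where "\<And>x. GDERIV f x :> df x" "\<And>v. C_k k (\<lambda>x. df x \<bullet> v)" "continuous_on UNIV df"
proof -
  obtain f' where f': "\<And>x. (f has_derivative f' x) (at x)" "\<And>b. b \<in> Basis \<Longrightarrow> C_k k (\<lambda>x. f' x b)"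
    using C_k_SucD[OF assms] by blast
  define df where "df x = (\<Sum>b\<in>Basis. f' x b *\<^sub>R b)" for x
  have e: "f' x h = h \<bullet> df x" for x h
  proof -
    have "f' x h = f' x (\<Sum>b\<in>Basis. (h \<bullet> b) *\<^sub>R b)" by (simp add: euclidean_representation)
    also have "\<dots> = (\<Sum>b\<in>Basis. (h \<bullet> b) * f' x b)"
      using has_derivative_linear[OF f'(1)] by (simp add: linear_sum linear_cmul)
    finally show ?thesis by (simp add: df_def inner_sum_right ac_simps)
  qed
  have 1: "GDERIV f x :> df x" for x
    using f'(1)[of x] by (simp add: gderiv_def e[symmetric])
  have sumC: "C_k k (\<lambda>x. \<Sum>b\<in>B. F b x)"
    if "finite B" "\<And>b. b \<in> B \<Longrightarrow> C_k k (F b)" for F :: "'a \<Rightarrow> 'a \<Rightarrow> 'c::real_normed_vector" and B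
    using that by (induction B rule: finite_induct) (auto intro: C_k_const C_k_add)
  have 2: "C_k k df" unfolding df_def
    by (intro sumC C_k_bounded_linear[OF bounded_linear_scaleR_left] f') auto
  have C0: "C_k n F \<Longrightarrow> continuous_on UNIV F" for n and F :: "'a \<Rightarrow> 'a"
    by (induction n) (auto simp del: C_k.simps(2) dest: C_k_Suc_imp)
  from that[OF 1] 2 C0[OF 2] C_k_bounded_linear[OF bounded_linear_inner_left 2] show thesis by auto
qed

section \<open>A smooth bump with compact support\<close>

definition flat :: "nat \<Rightarrow> real \<Rightarrow> real" where
  "flat n t = (if t > 0 then exp (- 1 / t) / t ^ n else 0)"

lemma flat_tendsto_0: "(flat n \<longlongrightarrow> 0) (at 0)"
proof -
  have "((\<lambda>t. inverse t ^ n / exp (inverse t)) \<longlongrightarrow> 0) (at_right (0::real))"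
    by (rule filterlim_compose[OF tendsto_power_div_exp_0 filterlim_inverse_at_top_right])
  moreover have "\<forall>\<^sub>F t in at_right 0. inverse t ^ n / exp (inverse t) = flat n t"
    by (auto simp: eventually_at_filter flat_def exp_minus field_simps power_inverse)
  ultimately have R: "(flat n \<longlongrightarrow> 0) (at_right 0)"
    by (rule Lim_transform_eventually)
  have L: "(flat n \<longlongrightarrow> 0) (at_left 0)"
    by (rule tendsto_eventually) (auto simp: eventually_at_filter flat_def)
  show ?thesis using L R by (simp add: filterlim_split_at)
qed

text \<open>The family \<open>flat n\<close> exists for this formula: its span is closed under
  differentiation, so smoothness of \<open>flat 0\<close> becomes an induction on the order with
  \<open>n\<close> left free.\<close>

lemma flat_deriv: "(flat n has_real_derivative flat (n + 2) t - n * flat (n + 1) t) (at t)"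
proof (cases t "0::real" rule: linorder_cases)
  case less
  have "((\<lambda>_. 0) has_real_derivative 0) (at t)" by simp
  then have "(flat n has_real_derivative 0) (at t)"
    by (rule has_field_derivative_transform_within_open[of _ _ _ "{..<0}"])
       (use less in \<open>auto simp: flat_def\<close>)
  then show ?thesis using less by (simp add: flat_def)
next
  case greater
  have e: "exp (- 1 / t) * (1 / t\<^sup>2) / t ^ n - exp (- 1 / t) * (n * t ^ (n - 1)) / (t ^ n * t ^ n)
     = flat (n + 2) t - n * flat (n + 1) t"
    using greater by (cases n) (auto simp: flat_def power2_eq_square divide_simps)
  have "((\<lambda>t. exp (- 1 / t) / t ^ n) has_real_derivative flat (n + 2) t - n * flat (n + 1) t) (at t)"
    unfolding e[symmetric] using greater
    by (auto intro!: derivative_eq_intros simp: power2_eq_square diff_divide_distrib)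
  then show ?thesis
    by (rule has_field_derivative_transform_within_open[of _ _ _ "{0<..}"])
       (use greater in \<open>auto simp: flat_def\<close>)
next
  case equal
  \<comment> \<open>At 0 the difference quotient of \<open>flat n\<close> is
    \<open>flat (n + 1)\<close>, which tends to 0.\<close>
  have "((\<lambda>y. (flat n y - flat n 0) / (y - 0)) \<longlongrightarrow> 0) (at 0)"
    by (rule Lim_transform_eventually[OF flat_tendsto_0[of "n + 1"]])
       (auto simp: flat_def eventually_at_filter divide_simps)
  then show ?thesis using equal by (simp add: has_field_derivative_iff flat_def)
qed

lemma C_k_flat:
  fixes q :: "'a::euclidean_space \<Rightarrow> real"
  assumes "smooth q"
  shows "C_k k (\<lambda>x. flat n (q x))"
proof (induction k arbitrary: n)
  case 0
  have "continuous_on UNIV (flat n)"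
    using flat_deriv by (intro DERIV_continuous_on[of UNIV]) (blast intro: has_field_derivative_at_within)
  moreover have "continuous_on UNIV q"
    using assms C_k.simps(1) unfolding smooth_def by blast
  ultimately show ?case by (auto intro: continuous_on_compose2)
next
  case (Suc k)
  have "C_k (Suc k) q" using assms by (simp add: smooth_def)
  then obtain q' where q': "\<And>x. (q has_derivative q' x) (at x)" "\<And>b. b \<in> Basis \<Longrightarrow> C_k k (\<lambda>x. q' x b)"
    using C_k_SucD by blast
  show ?case
  proof (rule C_k_SucI)
    show "((\<lambda>x. flat n (q x)) has_derivative
        (\<lambda>h. (flat (n + 2) (q x) - n * flat (n + 1) (q x)) * q' x h)) (at x)" for x
      by (rule has_derivative_compose[OF q'(1), of "flat n"])
         (use flat_deriv in \<open>simp add: has_field_derivative_def\<close>)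
  qed (intro C_k_mult C_k_diff C_k_const Suc.IH q')
qed

text \<open>The classical mollifier kernel exp (-1 / (e^2 - |x|^2)), left unnormalised: its integral
  is carried as a positive factor \<open>c\<close> through the mollification estimates.\<close>

definition bump :: "real \<Rightarrow> 'a::euclidean_space \<Rightarrow> real" where
  "bump e x = flat 0 (e\<^sup>2 - x \<bullet> x)"

lemma bump_nonneg: "bump e x \<ge> 0"
  by (simp add: bump_def flat_def)

lemma bump_pos_iff: "e > 0 \<Longrightarrow> bump e x > 0 \<longleftrightarrow> norm x < e"
  by (simp add: bump_def flat_def norm_lt_square power2_eq_square)

lemma bump_eq_0: "e > 0 \<Longrightarrow> norm x \<ge> e \<Longrightarrow> bump e x = 0"
  using bump_pos_iff[of e x] bump_nonneg[of e x] by linarith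

lemma smooth_bump: "smooth (bump e)"
proof -
  have "C_k k (\<lambda>x::'a. e\<^sup>2 - x \<bullet> x)" for k
  proof (cases k)
    case (Suc n)
    have "((\<lambda>x::'a. e\<^sup>2 - x \<bullet> x) has_derivative (\<lambda>h. (-2) * (x \<bullet> h))) (at x)" for x
      by (auto intro!: derivative_eq_intros simp: inner_commute)
    then show ?thesis unfolding Suc
      by (rule C_k_SucI) (intro C_k_mult C_k_const C_k_bounded_linear[OF bounded_linear_inner_left] C_k_ident)
  qed (auto intro!: continuous_intros)
  then show ?thesis unfolding bump_def [abs_def]
    using C_k_flat[of "\<lambda>x::'a. e\<^sup>2 - x \<bullet> x" _ 0] by (simp add: smooth_def)
qed

section \<open>Integration by parts and mollification\<close>

lemma compact_support_integrable:
  fixes f :: "'a::euclidean_space \<Rightarrow> 'b::euclidean_space"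
  assumes "continuous_on UNIV f" "\<And>x. norm x > R \<Longrightarrow> f x = 0"
  shows "integrable lborel f"
proof -
  have "integrable lborel (\<lambda>x. indicator (cball 0 R) x *\<^sub>R f x)"
    by (rule borel_integrable_compact) (auto intro: continuous_on_subset[OF assms(1)])
  moreover have "(\<lambda>x. indicator (cball 0 R) x *\<^sub>R f x) = f"
    using assms(2) by (force simp: indicator_def)
  ultimately show ?thesis by simp
qed

text \<open>Bridge from the Lebesgue integral over the whole space to the gauge integral over a box,
  where differentiation under the integral sign is available.\<close>

lemma compact_support_integral_cbox:
  fixes f :: "'a::euclidean_space \<Rightarrow> 'b::euclidean_space"
  assumes "continuous_on UNIV f" "\<And>x. norm x > R \<Longrightarrow> f x = 0" "cball 0 R \<subseteq> cbox a b"
  shows "integral (cbox a b) f = (\<integral>x. f x \<partial>lborel)"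
proof -
  have "integral (cbox a b) f = integral UNIV (\<lambda>x. if x \<in> cbox a b then f x else 0)"
    by (simp add: integral_restrict_UNIV)
  also have "(\<lambda>x. if x \<in> cbox a b then f x else 0) = f"
    using assms(2,3) by (force simp: subset_iff)
  finally show ?thesis using integral_lborel[OF compact_support_integrable[OF assms(1,2)]] by simp
qed

lemma GDERIV_unique: "GDERIV f x :> D \<Longrightarrow> GDERIV f x :> E \<Longrightarrow> D = E"
  unfolding gderiv_def by (drule (1) has_derivative_unique) (simp add: fun_eq_iff vector_eq_ldot)

lemma GDERIV_continuous: "(\<And>x. GDERIV f x :> df x) \<Longrightarrow> continuous_on S f"
  unfolding gderiv_def
  by (rule continuous_at_imp_continuous_on) (blast intro: has_derivative_continuous)

lemma GDERIV_transform_open: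
  assumes "GDERIV f x :> D" "open S" "x \<in> S" "\<And>y. y \<in> S \<Longrightarrow> f y = g y"
  shows "GDERIV g x :> D"
  using assms(1) unfolding gderiv_def
  by (rule has_derivative_transform_within_open) (use assms in auto)

lemma GDERIV_zero_outside:
  assumes "GDERIV f x :> D" "\<And>y. norm y > R \<Longrightarrow> f y = 0" "norm x > R"
  shows "D = 0"
proof (rule GDERIV_unique[OF assms(1)])
  have "open {y::'a. norm y > R}" by (intro open_Collect_less continuous_intros)
  then show "GDERIV f x :> 0"
    by (rule GDERIV_transform_open[OF GDERIV_const[of 0]]) (use assms in auto)
qed

lemma integral_lborel_translation:
  fixes f :: "'a::euclidean_space \<Rightarrow> 'b::euclidean_space"
  assumes "continuous_on UNIV f"
  shows "(\<integral>x. f (a + x) \<partial>lborel) = (\<integral>x. f x \<partial>lborel)"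
proof -
  have "f \<in> borel_measurable borel" by (rule borel_measurable_continuous_onI[OF assms])
  then have "(\<integral>x. f x \<partial>distr lborel borel ((+) a)) = (\<integral>x. f (a + x) \<partial>lborel)"
    by (intro integral_distr) auto
  then show ?thesis by (simp add: lborel_distr_plus)
qed

lemma integral_lborel_reflection:
  fixes f :: "'a::euclidean_space \<Rightarrow> 'b::euclidean_space"
  assumes "continuous_on UNIV f"
  shows "(\<integral>x. f (a - x) \<partial>lborel) = (\<integral>x. f x \<partial>lborel)"
proof -
  have "f \<in> borel_measurable borel" by (rule borel_measurable_continuous_onI[OF assms])
  then have "(\<integral>x. f x \<partial>distr lborel borel (\<lambda>x. a + (-1) *\<^sub>R x)) = (\<integral>x. f (a - x) \<partial>lborel)"
    by (subst integral_distr) auto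
  moreover have "distr lborel borel (\<lambda>x::'a. a + (-1) *\<^sub>R x) = lborel"
    using lborel_affine[of "-1" a] by (simp add: density_1)
  ultimately show ?thesis by simp
qed

text \<open>By translation invariance the integral of h (t v + x) over x does not depend on t. Its
  derivative at t = 0, taken under the integral sign, is the integral in question.\<close>

lemma integral_gradient_eq_0:
  fixes h :: "'a::euclidean_space \<Rightarrow> real"
  assumes dh: "\<And>x. GDERIV h x :> dh x" and cont: "continuous_on UNIV dh"
    and supp: "\<And>x. norm x > R \<Longrightarrow> h x = 0"
  shows "(\<integral>x. v \<bullet> dh x \<partial>lborel) = 0"
proof -
  \<comment> \<open>The margin \<open>norm v\<close> keeps the supports of all translates by t v
    with |t| < 1 inside one box.\<close>
  obtain b :: 'a where b: "cball 0 (\<bar>R\<bar> + norm v) \<subseteq> cbox (-b) b"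
    using bounded_subset_cbox_symmetric[OF bounded_cball] by blast
  have hc: "continuous_on S h" for S using GDERIV_continuous[OF dh] .
  define I where "I t = integral (cbox (-b) b) (\<lambda>x. h (t *\<^sub>R v + x))" for t
  have "(I has_field_derivative integral (cbox (-b) b) (\<lambda>x. v \<bullet> dh (0 *\<^sub>R v + x)))
      (at 0 within {-1<..<1})"
    unfolding I_def
  proof (rule leibniz_rule_field_derivative)
    fix t x
    have "((\<lambda>t. h (t *\<^sub>R v + x)) has_derivative (\<lambda>s. (s *\<^sub>R v) \<bullet> dh (t *\<^sub>R v + x))) (at t)"
      by (rule has_derivative_compose[of "\<lambda>t. t *\<^sub>R v + x", OF _ dh[unfolded gderiv_def]])
        (auto intro!: derivative_eq_intros)
    then show "((\<lambda>t. h (t *\<^sub>R v + x)) has_field_derivative v \<bullet> dh (t *\<^sub>R v + x)) (at t within {-1<..<1})"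
      by (auto simp: has_field_derivative_def mult_commute_abs intro: has_derivative_at_withinI)
  next
    fix t :: real
    show "(\<lambda>x. h (t *\<^sub>R v + x)) integrable_on cbox (-b) b"
      by (intro integrable_continuous continuous_on_compose2[OF hc[of UNIV]] continuous_intros) auto
  next
    show "continuous_on ({-1<..<1} \<times> cbox (-b) b) (\<lambda>(t, x). v \<bullet> dh (t *\<^sub>R v + x))"
      unfolding case_prod_unfold
      by (intro continuous_on_inner continuous_on_const continuous_on_compose2[OF cont] continuous_intros) auto
  qed auto
  then have d: "(I has_field_derivative integral (cbox (-b) b) (\<lambda>x. v \<bullet> dh x)) (at 0)"
    by (simp add: at_within_open[of _ "{-1<..<1::real}"])
  have I: "I t = (\<integral>x. h x \<partial>lborel)" if "t \<in> {-1<..<1}" for t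
  proof -
    have "I t = (\<integral>x. h (t *\<^sub>R v + x) \<partial>lborel)"
      unfolding I_def
    proof (rule compact_support_integral_cbox[OF _ _ b])
      show "continuous_on UNIV (\<lambda>x. h (t *\<^sub>R v + x))"
        by (intro continuous_on_compose2[OF hc[of UNIV]] continuous_intros) auto
      fix x :: 'a assume *: "\<bar>R\<bar> + norm v < norm x"
      have "norm (t *\<^sub>R v) \<le> norm v"
        using that mult_right_mono[of "\<bar>t\<bar>" 1 "norm v"] by (simp add: abs_le_iff)
      with * have "norm (t *\<^sub>R v + x) > R"
        using norm_diff_ineq[of x "t *\<^sub>R v"] by (simp add: add.commute)
      then show "h (t *\<^sub>R v + x) = 0" by (rule supp)
    qed
    then show ?thesis using integral_lborel_translation[OF hc] by simp
  qed
  have "(I has_field_derivative 0) (at 0)"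
    by (rule has_field_derivative_transform_within_open[OF DERIV_const, where S = "{-1<..<1}"]) (use I in auto)
  then have "integral (cbox (-b) b) (\<lambda>x. v \<bullet> dh x) = 0"
    by (rule DERIV_unique[OF d])
  moreover have "integral (cbox (-b) b) (\<lambda>x. v \<bullet> dh x) = (\<integral>x. v \<bullet> dh x \<partial>lborel)"
  proof (rule compact_support_integral_cbox[OF _ _ b])
    show "continuous_on UNIV (\<lambda>x. v \<bullet> dh x)" by (intro continuous_intros cont)
    show "v \<bullet> dh x = 0" if "\<bar>R\<bar> + norm v < norm x" for x
    proof -
      have "R < norm x" using that norm_ge_zero[of v] by linarith
      then show ?thesis by (simp add: GDERIV_zero_outside[OF dh supp])
    qed
  qed
  ultimately show ?thesis by simp
qed

section \<open>Convolution with the bump and passage to C^1 test functions\<close>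

lemma convolution_has_derivative:
  fixes w b :: "'a::euclidean_space \<Rightarrow> real"
  assumes w: "continuous_on UNIV w" and db: "\<And>x. GDERIV b x :> db x" and cont: "continuous_on UNIV db"
  shows "((\<lambda>x. integral (cbox a c) (\<lambda>y. w y * b (x - y))) has_derivative
    (\<lambda>h. integral (cbox a c) (\<lambda>y. w y * (h \<bullet> db (x - y))))) (at x)"
proof -
  \<comment> \<open>The Leibniz rule for Frechet derivatives integrates an operator-valued map, so
    the derivative is packaged as a bounded linear function.\<close>
  define fx where "fx x y = w y *\<^sub>R blinfun_inner_left (db (x - y))" for x y
  have bc: "continuous_on UNIV b" using GDERIV_continuous[OF db] .
  have fx: "blinfun_apply (fx x y) = (\<lambda>h. w y * (h \<bullet> db (x - y)))" for x y
    by (auto simp: fx_def blinfun.scaleR_left)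
  have c1: "continuous_on S (\<lambda>(x, y). fx x y)" for S
    unfolding fx_def case_prod_unfold
    by (intro continuous_on_scaleR bounded_linear.continuous_on[OF bounded_linear_blinfun_inner_left]
        continuous_on_compose2[OF cont] continuous_on_compose2[OF w] continuous_intros) auto
  have "((\<lambda>x. integral (cbox a c) (\<lambda>y. w y * b (x - y))) has_derivative
      blinfun_apply (integral (cbox a c) (fx x))) (at x)"
  proof (rule leibniz_rule)
    fix x y
    have "((\<lambda>x. b (x - y)) has_derivative (\<lambda>h. h \<bullet> db (x - y))) (at x)"
      by (rule has_derivative_compose[of "\<lambda>x. x - y", OF _ db[unfolded gderiv_def]])
        (auto intro!: derivative_eq_intros)
    then show "((\<lambda>x. w y * b (x - y)) has_derivative blinfun_apply (fx x y)) (at x)"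
      unfolding fx by (rule has_derivative_mult_right)
    show "(\<lambda>y. w y * b (x - y)) integrable_on cbox a c"
      by (intro integrable_continuous continuous_intros continuous_on_compose2[OF bc]
          continuous_on_compose2[OF w]) auto
  qed (auto intro: c1)
  moreover have "blinfun_apply (integral (cbox a c) (fx x))
      = (\<lambda>h. integral (cbox a c) (\<lambda>y. w y * (h \<bullet> db (x - y))))"
  proof
    fix h
    have "continuous_on (cbox a c) (fx x)"
      using continuous_on_compose2[OF c1[of UNIV], of "cbox a c" "\<lambda>y. (x, y)"]
      by (simp add: continuous_on_Pair)
    then show "blinfun_apply (integral (cbox a c) (fx x)) h
      = integral (cbox a c) (\<lambda>y. w y * (h \<bullet> db (x - y)))"
      by (subst blinfun_apply_integral) (auto intro: integrable_continuous simp: fx)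
  qed
  ultimately show ?thesis by metis
qed

text \<open>Every derivative falls on \<open>b\<close>, so continuity of \<open>w\<close> suffices:
  the derivative in a direction is again such a convolution, with \<open>b\<close> replaced by its
  directional derivative.\<close>

lemma C_k_convolution:
  fixes w b :: "'a::euclidean_space \<Rightarrow> real"
  assumes "continuous_on UNIV w" "C_k k b"
  shows "C_k k (\<lambda>x. integral (cbox a c) (\<lambda>y. w y * b (x - y)))"
  using assms(2)
proof (induction k arbitrary: b)
  case 0
  then have "continuous_on UNIV b" by simp
  then have "continuous_on (UNIV \<times> cbox a c) (\<lambda>(x, y). w y * b (x - y))"
    unfolding case_prod_unfold
    by (intro continuous_on_mult continuous_on_compose2[OF assms(1), of _ snd]
        continuous_on_compose2[of UNIV b _ "\<lambda>z. fst z - snd z"])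
      (auto intro!: continuous_intros)
  then show ?case by (simp add: integral_continuous_on_param)
next
  case (Suc k)
  obtain db where db: "\<And>x. GDERIV b x :> db x" "\<And>v. C_k k (\<lambda>x. db x \<bullet> v)" "continuous_on UNIV db"
    by (rule C_k_gradient[OF Suc.prems]) (rule that)
  show ?case
    by (rule C_k_SucI[OF convolution_has_derivative[OF assms(1) db(1,3)]])
       (use Suc.IH[OF db(2)] in \<open>simp add: inner_commute\<close>)
qed

text \<open>A continuous nonnegative function with zero integral over a box with nonempty interior
  vanishes on that box, whereas the bump is positive at the origin.\<close>

lemma integral_bump_pos:
  assumes "e > 0"
  shows "(LINT x|lborel. bump e (x::'a::euclidean_space)) > 0"
proof -
  have c: "continuous_on UNIV (bump e :: 'a \<Rightarrow> real)"
    using smooth_bump C_k.simps(1) unfolding smooth_def by blast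
  obtain b :: 'a where b: "cball 0 e \<subseteq> cbox (-b) b"
    using bounded_subset_cbox_symmetric[OF bounded_cball] by blast
  have eq: "integral (cbox (-b) b) (bump e :: 'a \<Rightarrow> real) = (LINT x|lborel. bump e (x::'a))"
    by (rule compact_support_integral_cbox[OF c _ b]) (simp add: bump_eq_0[OF assms])
  have 0: "(0::'a) \<in> cball 0 e" using assms by simp
  then have "0 \<in> cbox (-b) b" using b by blast
  have "integral (cbox (-b) b) (bump e :: 'a \<Rightarrow> real) \<noteq> 0"
  proof
    assume z: "integral (cbox (-b) b) (bump e :: 'a \<Rightarrow> real) = 0"
    have "box (-b) b \<noteq> {}"
    proof -
      have "0 < b \<bullet> i" if "i \<in> Basis" for i :: 'a
      proof -
        have "e *\<^sub>R i \<in> cbox (-b) b" using b assms that by (auto simp: subset_iff)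
        then have "e \<le> b \<bullet> i" using that by (auto simp: mem_box inner_Basis)
        then show ?thesis using assms by simp
      qed
      then have "0 \<in> box (-b) b" by (auto simp: mem_box)
      then show ?thesis by blast
    qed
    moreover have "(bump e has_integral 0) (cbox (-b) b)"
      using integrable_continuous[OF continuous_on_subset[OF c], of "-b" b] z
      by (metis has_integral_integral subset_UNIV)
    ultimately have "bump e (0::'a) = 0"
      using has_integral_0_cbox_imp_0[of "-b" b "bump e"] \<open>0 \<in> cbox (-b) b\<close>
      by (metis bump_nonneg c continuous_on_subset subset_UNIV)
    then show False using bump_pos_iff[OF assms, of "0::'a"] assms by simp
  qed
  moreover have "(LINT x|lborel. bump e (x::'a)) \<ge> 0"
    by (rule Bochner_Integration.integral_nonneg) (auto intro: bump_nonneg)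
  ultimately show ?thesis using eq by simp
qed

text \<open>The derivative of the mollification can be placed on either factor. On the bump it gives
  smoothness; moved to \<open>w\<close> by integration by parts, it shows \<open>d\<eta>\<close> to
  be a weighted average of \<open>dw\<close>, which can be compared with \<open>dw\<close>
  itself.\<close>

lemma mollification_gradient:
  fixes w :: "'a::euclidean_space \<Rightarrow> real"
  assumes dw: "\<And>x. GDERIV w x :> dw x" and cont: "continuous_on UNIV dw"
    and supp: "\<And>x. norm x > R \<Longrightarrow> w x = 0" and e: "e > 0"
  defines "\<eta> \<equiv> (\<lambda>x. \<integral>y. w y * bump e (x - y) \<partial>lborel)"
    and "d\<eta> \<equiv> (\<lambda>x. \<integral>y. bump e (x - y) *\<^sub>R dw y \<partial>lborel)"
  shows "smooth \<eta>" "GDERIV \<eta> x :> d\<eta> x" "norm x > R + e \<Longrightarrow> \<eta> x = 0" "norm x > R + e \<Longrightarrow> d\<eta> x = 0"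
proof -
  have wc: "continuous_on S w" for S using GDERIV_continuous[OF dw] .
  obtain b :: 'a where b: "cball 0 R \<subseteq> cbox (-b) b"
    using bounded_subset_cbox_symmetric[OF bounded_cball] by blast
  have "C_k (Suc 0) (bump e :: 'a \<Rightarrow> real)" using smooth_bump unfolding smooth_def by blast
  then obtain db :: "'a \<Rightarrow> 'a" where db: "\<And>x. GDERIV (bump e) x :> db x" "continuous_on UNIV db"
    by (rule C_k_gradient) (rule that)
  have bc: "continuous_on UNIV (bump e :: 'a \<Rightarrow> real)" using GDERIV_continuous[OF db(1)] .
  have bc': "continuous_on UNIV (\<lambda>y. bump e (x - y))" for x :: 'a
    by (rule continuous_on_compose2[OF bc]) (auto intro!: continuous_intros)
  have dbc': "continuous_on UNIV (\<lambda>y. db (x - y))" for x :: 'a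
    by (rule continuous_on_compose2[OF db(2)]) (auto intro!: continuous_intros)
  have eta: "\<eta> = (\<lambda>x. integral (cbox (-b) b) (\<lambda>y. w y * bump e (x - y)))"
    unfolding \<eta>_def
    by (rule ext, rule compact_support_integral_cbox[OF _ _ b, symmetric])
      (auto intro!: continuous_intros wc bc' simp: supp)
  show "smooth \<eta>" unfolding eta smooth_def
    using C_k_convolution[OF wc, of _ "bump e"] smooth_bump unfolding smooth_def by blast
  have dw0: "norm y > R \<Longrightarrow> dw y = 0" for y
    using GDERIV_zero_outside[OF dw supp] .
  have i1: "integrable lborel (\<lambda>y. bump e (x - y) *\<^sub>R dw y)" for x
    by (rule compact_support_integrable[of _ R]) (auto intro!: continuous_intros cont bc' simp: dw0)
  have i2: "integrable lborel (\<lambda>y. w y *\<^sub>R db (x - y))" for x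
    by (rule compact_support_integrable[of _ R]) (auto intro!: continuous_intros wc dbc' simp: supp)
  have "integral (cbox (-b) b) (\<lambda>y. w y * (h \<bullet> db (x - y))) = h \<bullet> d\<eta> x" for h
  proof -
    have "integral (cbox (-b) b) (\<lambda>y. w y * (h \<bullet> db (x - y))) = (\<integral>y. w y * (h \<bullet> db (x - y)) \<partial>lborel)"
      by (rule compact_support_integral_cbox[OF _ _ b]) (auto intro!: continuous_intros wc dbc' simp: supp)
    also have "\<dots> = (\<integral>y. h \<bullet> (w y *\<^sub>R db (x - y)) \<partial>lborel)" by simp
    also have "\<dots> = h \<bullet> (\<integral>y. w y *\<^sub>R db (x - y) \<partial>lborel)"
      by (rule integral_inner_right) (rule i2)
    finally have 1: "integral (cbox (-b) b) (\<lambda>y. w y * (h \<bullet> db (x - y)))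
        = h \<bullet> (\<integral>y. w y *\<^sub>R db (x - y) \<partial>lborel)" .
    \<comment> \<open>The integrand is h paired with the gradient in y of w y * bump e (x - y). Its
      zero integral moves the derivative from the bump to \<open>w\<close>.\<close>
    have "(\<integral>y. h \<bullet> (w y *\<^sub>R - db (x - y) + bump e (x - y) *\<^sub>R dw y) \<partial>lborel) = 0"
    proof (rule integral_gradient_eq_0[where R = R])
      fix y
      have "((\<lambda>y. bump e (x - y)) has_derivative (\<lambda>h. (- h) \<bullet> db (x - y))) (at y)"
        by (rule has_derivative_compose[of "\<lambda>y. x - y", OF _ db(1)[unfolded gderiv_def]])
          (auto intro!: derivative_eq_intros)
      then have "GDERIV (\<lambda>y. bump e (x - y)) y :> - db (x - y)"
        by (simp add: gderiv_def)
      then show "GDERIV (\<lambda>y. w y * bump e (x - y)) y :> w y *\<^sub>R - db (x - y) + bump e (x - y) *\<^sub>R dw y"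
        by (rule GDERIV_mult[OF dw])
    next
      show "continuous_on UNIV (\<lambda>y. w y *\<^sub>R - db (x - y) + bump e (x - y) *\<^sub>R dw y)"
        by (intro continuous_intros wc dbc' bc' cont)
    qed (simp add: supp)
    moreover have "(\<integral>y. h \<bullet> (w y *\<^sub>R - db (x - y) + bump e (x - y) *\<^sub>R dw y) \<partial>lborel)
        = h \<bullet> (\<integral>y. w y *\<^sub>R - db (x - y) + bump e (x - y) *\<^sub>R dw y \<partial>lborel)"
      by (rule integral_inner_right) (use i1 i2 in auto)
    moreover have "(\<integral>y. w y *\<^sub>R - db (x - y) + bump e (x - y) *\<^sub>R dw y \<partial>lborel)
        = d\<eta> x - (\<integral>y. w y *\<^sub>R db (x - y) \<partial>lborel)"
      unfolding d\<eta>_def using i1 i2 by (subst Bochner_Integration.integral_add) auto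
    ultimately show ?thesis using 1 by (simp add: inner_diff_right)
  qed
  then show "GDERIV \<eta> x :> d\<eta> x"
    using convolution_has_derivative[OF wc db, of "-b" b x] unfolding eta gderiv_def by simp
  assume x: "norm x > R + e"
  have *: "bump e (x - y) = 0" if "norm y \<le> R" for y
    using norm_triangle_ineq2[of x y] x that by (intro bump_eq_0 e) auto
  have "w y * bump e (x - y) = 0" for y
    using * supp by (cases "norm y \<le> R") auto
  then show "\<eta> x = 0" unfolding \<eta>_def by (simp only: Bochner_Integration.integral_zero)
  have "bump e (x - y) *\<^sub>R dw y = 0" for y
    using * dw0 by (cases "norm y \<le> R") auto
  then show "d\<eta> x = 0" unfolding d\<eta>_def by (simp only: Bochner_Integration.integral_zero)
qed

text \<open>Since \<open>bump e\<close> lives on the ball of radius e, only the oscillation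
  \<open>d\<close> of \<open>dw\<close> within distance e of x enters; the factor \<open>c\<close>
  is the total mass of the bump.\<close>

lemma mollification_gradient_error:
  fixes dw :: "'a::euclidean_space \<Rightarrow> 'a" and x :: 'a
  assumes cont: "continuous_on UNIV dw" and supp: "\<And>x. norm x > R \<Longrightarrow> dw x = 0" and e: "e > 0"
    and d: "\<And>y. norm (x - y) < e \<Longrightarrow> norm (dw y - dw x) \<le> d"
  defines "c \<equiv> (\<integral>y. bump e (y::'a) \<partial>lborel)"
  shows "norm ((\<integral>y. bump e (x - y) *\<^sub>R dw y \<partial>lborel) - c *\<^sub>R dw x) \<le> c * d"
proof -
  have bc: "continuous_on UNIV (bump e :: 'a \<Rightarrow> real)"
    using smooth_bump C_k.simps(1) unfolding smooth_def by blast
  have bc': "continuous_on UNIV (\<lambda>y. bump e (x - y))"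
    by (rule continuous_on_compose2[OF bc]) (auto intro!: continuous_intros)
  have b0: "bump e (x - y) = 0" if "norm y > norm x + e" for y
    using norm_triangle_ineq2[of y x] that by (intro bump_eq_0 e) (auto simp: norm_minus_commute)
  have ib: "integrable lborel (\<lambda>y. bump e (x - y))"
    by (rule compact_support_integrable[OF bc' b0])
  have c: "c = (\<integral>y. bump e (x - y) \<partial>lborel)"
    unfolding c_def by (rule integral_lborel_reflection[OF bc, symmetric])
  have i1: "integrable lborel (\<lambda>y. bump e (x - y) *\<^sub>R dw y)"
    by (rule compact_support_integrable[of _ R]) (auto intro!: continuous_intros cont bc' simp: supp)
  have i2: "integrable lborel (\<lambda>y. bump e (x - y) *\<^sub>R dw x)"
    using ib by simp
  have i3: "integrable lborel (\<lambda>y. bump e (x - y) *\<^sub>R (dw y - dw x))"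
    using Bochner_Integration.integrable_diff[OF i1 i2] by (simp add: scaleR_diff_right)
  have "(\<integral>y. bump e (x - y) *\<^sub>R dw y \<partial>lborel) - c *\<^sub>R dw x
      = (\<integral>y. bump e (x - y) *\<^sub>R (dw y - dw x) \<partial>lborel)"
    using Bochner_Integration.integral_diff[OF i1 i2] ib by (simp add: scaleR_diff_right c)
  also have "norm \<dots> \<le> (\<integral>y. norm (bump e (x - y) *\<^sub>R (dw y - dw x)) \<partial>lborel)"
    by (rule integral_norm_bound)
  also have "\<dots> \<le> (\<integral>y. bump e (x - y) * d \<partial>lborel)"
  proof (rule integral_mono)
    show "norm (bump e (x - y) *\<^sub>R (dw y - dw x)) \<le> bump e (x - y) * d" for y
      using d[of y] bump_eq_0[OF e, of "x - y"] bump_nonneg[of e "x - y"]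
      by (cases "norm (x - y) < e") (auto intro: mult_left_mono)
  qed (use integrable_norm[OF i3] ib in auto)
  also have "\<dots> = c * d" using c by simp
  finally show ?thesis .
qed

text \<open>Extends a weak inequality from smooth to C^1 test functions, as needed for squared
  positive parts. The mollification of \<open>w\<close> is an admissible test function, and its
  gradient is uniformly close to \<open>c *\<^sub>R dw\<close>.\<close>

lemma weak_inequality_C1:
  fixes F :: "'a::euclidean_space \<Rightarrow> 'a"
  assumes F: "continuous_on UNIV F"
    and weak: "\<And>\<eta> d\<eta>. smooth \<eta> \<Longrightarrow> compact (closure {x. \<eta> x \<noteq> 0}) \<Longrightarrow> (\<And>x. \<eta> x \<ge> 0) \<Longrightarrow>
      (\<And>x. GDERIV \<eta> x :> d\<eta> x) \<Longrightarrow> (\<integral>x. F x \<bullet> d\<eta> x \<partial>lborel) \<le> 0"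
    and dw: "\<And>x. GDERIV w x :> dw x" and cont: "continuous_on UNIV dw"
    and supp: "\<And>x. norm x > R \<Longrightarrow> w x = 0" and nonneg: "\<And>x. w x \<ge> 0"
  shows "(\<integral>x. F x \<bullet> dw x \<partial>lborel) \<le> 0"
proof (rule field_le_epsilon)
  fix \<delta> :: real assume \<delta>: "\<delta> > 0"
  let ?S = "cball 0 (R + 1) :: 'a set"
  have dw0: "norm y > R \<Longrightarrow> dw y = 0" for y
    using GDERIV_zero_outside[OF dw supp] .
  define N where "N = (\<integral>x. indicator ?S x * norm (F x) \<partial>lborel)"
  have iN: "integrable lborel (\<lambda>x. indicator ?S x * norm (F x))"
    using borel_integrable_compact[of ?S "\<lambda>x. norm (F x)"] continuous_on_subset[OF F]
    by (auto intro: continuous_on_norm)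
  have N0: "N \<ge> 0" unfolding N_def by (rule Bochner_Integration.integral_nonneg) auto
  \<comment> \<open>Chosen so that the total error d * N stays below \<delta>, also when N =
    0.\<close>
  define d where "d = \<delta> / (N + 1)"
  have d0: "d > 0" using \<delta> N0 by (simp add: d_def)
  \<comment> \<open>The mollified gradient lives in the ball of radius R + 1 and averages
    \<open>dw\<close> over distances e \<le> 1, hence the radius R + 2.\<close>
  have "uniformly_continuous_on (cball 0 (R + 2)) dw"
    by (rule compact_uniformly_continuous[OF continuous_on_subset[OF cont]]) auto
  then obtain e0 where e0: "e0 > 0" "\<And>x y. x \<in> cball 0 (R + 2) \<Longrightarrow> y \<in> cball 0 (R + 2) \<Longrightarrow>
      dist y x < e0 \<Longrightarrow> dist (dw y) (dw x) < d"
    using d0 unfolding uniformly_continuous_on_def by metis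
  define e where "e = min e0 1"
  have e: "e > 0" "e \<le> 1" "e \<le> e0" using e0 by (auto simp: e_def)
  define c where "c = (LINT y|lborel. bump e (y::'a))"
  have c: "c > 0" unfolding c_def by (rule integral_bump_pos[OF e(1)])
  define \<eta> where "\<eta> = (\<lambda>x. \<integral>y. w y * bump e (x - y) \<partial>lborel)"
  define d\<eta> where "d\<eta> = (\<lambda>x. \<integral>y. bump e (x - y) *\<^sub>R dw y \<partial>lborel)"
  have m: "smooth \<eta>" "\<And>x. GDERIV \<eta> x :> d\<eta> x" "\<And>x. norm x > R + e \<Longrightarrow> \<eta> x = 0"
      "\<And>x. norm x > R + e \<Longrightarrow> d\<eta> x = 0"
    unfolding \<eta>_def d\<eta>_def using mollification_gradient[OF dw cont supp e(1)] by blast+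
  have err: "norm (d\<eta> x - c *\<^sub>R dw x) \<le> c * (d * indicator ?S x)" for x
  proof (cases "x \<in> ?S")
    case True
    have "norm (dw y - dw x) \<le> d" if "norm (x - y) < e" for y
    proof -
      have "norm y \<le> norm x + norm (x - y)"
        using norm_triangle_ineq4[of x "x - y"] by simp
      then have "y \<in> cball 0 (R + 2)" using True that e by auto
      moreover have "x \<in> cball 0 (R + 2)" using True by auto
      ultimately have "dist (dw y) (dw x) < d" using e0(2)[of x y] that e by (auto simp: dist_norm norm_minus_commute)
      then show ?thesis by (simp add: dist_norm)
    qed
    from mollification_gradient_error[OF cont dw0 e(1) this] show ?thesis
      using True by (simp add: d\<eta>_def c_def)
  next
    case False
    then have "norm x > R + 1" by simp
    then have "d\<eta> x = 0" "dw x = 0" using e by (auto intro!: m(4) dw0)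
    then show ?thesis using False by simp
  qed
  have bounded: "bounded {x. \<eta> x \<noteq> 0}"
    using m(3) by (intro boundedI[of _ "R + e"]) (metis mem_Collect_eq not_le_imp_less)
  have le0: "(\<integral>x. F x \<bullet> d\<eta> x \<partial>lborel) \<le> 0"
  proof (rule weak[OF m(1) _ _ m(2)])
    show "compact (closure {x. \<eta> x \<noteq> 0})" using bounded by simp
    show "\<eta> x \<ge> 0" for x unfolding \<eta>_def
      by (rule Bochner_Integration.integral_nonneg) (simp add: nonneg bump_nonneg)
  qed
  have "C_k (Suc 0) \<eta>" using m(1) unfolding smooth_def by blast
  then obtain d\<eta>' where "\<And>x. GDERIV \<eta> x :> d\<eta>' x" "continuous_on UNIV d\<eta>'"
    by (rule C_k_gradient) (rule that)
  then have d\<eta>c: "continuous_on UNIV d\<eta>"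
    using GDERIV_unique[OF m(2)] by (metis continuous_on_eq)
  have i1: "integrable lborel (\<lambda>x. F x \<bullet> d\<eta> x)"
    using m(4) by (intro compact_support_integrable[of _ "R + e"] continuous_intros F d\<eta>c) auto
  have i2: "integrable lborel (\<lambda>x. F x \<bullet> dw x)"
    using dw0 by (intro compact_support_integrable[of _ R] continuous_intros F cont) auto
  have "c * (\<integral>x. F x \<bullet> dw x \<partial>lborel) = (\<integral>x. c * (F x \<bullet> dw x) \<partial>lborel)" by simp
  also have "\<dots> \<le> (\<integral>x. F x \<bullet> d\<eta> x + c * d * (indicator ?S x * norm (F x)) \<partial>lborel)"
  proof (rule integral_mono)
    fix x
    have "c * (F x \<bullet> dw x) - F x \<bullet> d\<eta> x = F x \<bullet> (c *\<^sub>R dw x - d\<eta> x)"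
      by (simp add: inner_diff_right)
    also have "\<dots> \<le> norm (F x) * norm (c *\<^sub>R dw x - d\<eta> x)" by (rule norm_cauchy_schwarz)
    also have "\<dots> \<le> norm (F x) * (c * (d * indicator ?S x))"
      using err[of x] by (intro mult_left_mono) (auto simp: norm_minus_commute)
    finally show "c * (F x \<bullet> dw x) \<le> F x \<bullet> d\<eta> x + c * d * (indicator ?S x * norm (F x))"
      by (simp add: algebra_simps)
  qed (use i1 i2 iN in auto)
  also have "\<dots> = (\<integral>x. F x \<bullet> d\<eta> x \<partial>lborel) + c * d * N"
    using i1 iN by (simp add: N_def)
  also have "\<dots> \<le> c * (d * N)" using le0 by simp
  finally have "(\<integral>x. F x \<bullet> dw x \<partial>lborel) \<le> d * N" using c by simp
  also have "\<dots> \<le> \<delta>" using N0 \<delta> by (simp add: d_def field_simps)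
  finally show "(\<integral>x. F x \<bullet> dw x \<partial>lborel) \<le> 0 + \<delta>" by simp
qed

section \<open>Curvature in polar form\<close>

abbreviation dir :: "real \<Rightarrow> real^2" where
  "dir \<theta> \<equiv> vector [cos \<theta>, sin \<theta>]"

lemma inner_2: "(x::real^2) \<bullet> y = x $ 1 * y $ 1 + x $ 2 * y $ 2"
  by (simp add: inner_vec_def sum_2)

lemma polar_eq: "polar (vector [\<theta>, r]) = r *\<^sub>R dir \<theta>"
  by (simp add: polar_def vec_eq_iff forall_2)

lemma norm_dir: "norm (dir \<theta>) = 1"
  by (simp add: norm_eq_sqrt_inner inner_2 flip: power2_eq_square)

lemma polar_cases:
  fixes x :: "real^2"
  obtains \<theta> where "x = norm x *\<^sub>R dir \<theta>"
proof (cases "x = 0")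
  case False
  define n where "n = norm x"
  have n: "n > 0" "n\<^sup>2 = (x $ 1)\<^sup>2 + (x $ 2)\<^sup>2"
    using False by (simp add: n_def, simp add: n_def power2_norm_eq_inner inner_2 flip: power2_eq_square)
  have "(x $ 1 / n)\<^sup>2 + (x $ 2 / n)\<^sup>2 = 1"
    unfolding power_divide add_divide_distrib[symmetric] n(2)[symmetric] using n(1) by simp
  then obtain t where "x $ 1 / n = cos t" "x $ 2 / n = sin t"
    using sincos_total_2pi by metis
  then have "x = n *\<^sub>R dir t"
    using n by (simp add: vec_eq_iff forall_2 field_simps)
  then show ?thesis using that[of t] n_def by simp
qed (use that in simp)

lemma polar_has_derivative:
  "(polar has_derivative (\<lambda>h. (h $ 2 * cos (y $ 1) - y $ 2 * sin (y $ 1) * h $ 1) *\<^sub>R axis 1 1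
     + (h $ 2 * sin (y $ 1) + y $ 2 * cos (y $ 1) * h $ 1) *\<^sub>R axis 2 1)) (at y)"
proof -
  have *: "polar = (\<lambda>y. (y $ 2 * cos (y $ 1)) *\<^sub>R axis 1 1 + (y $ 2 * sin (y $ 1)) *\<^sub>R axis 2 1)"
    by (simp add: fun_eq_iff polar_def vec_eq_iff forall_2 axis_def)
  show ?thesis unfolding *
    by (auto intro!: derivative_eq_intros bounded_linear.has_derivative[OF bounded_linear_vec_nth]
        simp: algebra_simps)
qed

lemma jacobian_polar:
  "jacobian polar (at y) = vector [vector [- (y $ 2 * sin (y $ 1)), cos (y $ 1)],
     vector [y $ 2 * cos (y $ 1), sin (y $ 1)]]"
proof -
  have "frechet_derivative polar (at y) = (\<lambda>h. (h $ 2 * cos (y $ 1) - y $ 2 * sin (y $ 1) * h $ 1) *\<^sub>R axis 1 1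
     + (h $ 2 * sin (y $ 1) + y $ 2 * cos (y $ 1) * h $ 1) *\<^sub>R axis 2 1)"
    using frechet_derivative_at[OF polar_has_derivative] by metis
  then show ?thesis
    by (simp add: jacobian_def matrix_def vec_eq_iff forall_2 axis_def)
qed

lemma matrix_inv_unique:
  fixes A B :: "'a::semiring_1^'n^'n"
  assumes "A ** B = mat 1" "B ** A = mat 1"
  shows "matrix_inv A = B"
  unfolding matrix_inv_def
proof (rule some_equality)
  fix A' assume A': "A ** A' = mat 1 \<and> A' ** A = mat 1"
  have "A' = A' ** (A ** B)" using assms by simp
  also have "\<dots> = B" using A' by (simp only: matrix_mul_assoc matrix_mul_lid)
  finally show "A' = B" .
qed (use assms in simp)

locale polar_metric_on_plane =
  fixes g :: metric_field and \<phi> :: "real \<Rightarrow> real \<Rightarrow> real"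
  assumes metric: "riemannian_metric g" and polar_form: "has_polar_form g \<phi>"
begin

lemma symmetric: "g x $ 2 $ 1 = g x $ 1 $ 2"
proof -
  have "transpose (g x) $ 1 $ 2 = g x $ 1 $ 2"
    using metric by (simp add: riemannian_metric_def)
  then show ?thesis by (simp add: transpose_def)
qed

lemma positive: "v \<noteq> 0 \<Longrightarrow> v \<bullet> (g x *v v) > 0"
  using metric by (simp add: riemannian_metric_def)

lemma pullback_components:
  fixes \<theta> r :: real
  defines "h \<equiv> pullback_metric polar g (vector [\<theta>, r])"
  assumes r: "r > 0"
  shows "h $ 1 $ 1 = (\<phi> \<theta> r)\<^sup>2" "h $ 1 $ 2 = 0" "h $ 2 $ 1 = 0" "h $ 2 $ 2 = 1"
  using polar_form r unfolding has_polar_form_def h_def by (auto simp: polar_metric_def)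

text \<open>The Gauss lemma in Cartesian form. The second column of the pulled-back metric says that
  \<open>g x *v dir \<theta>\<close> is Euclidean-orthogonal to the angular direction and has inner
  product 1 with \<open>dir \<theta>\<close>, so it equals \<open>dir \<theta>\<close>.\<close>

lemma radial: "g x *v x = x"
proof -
  obtain \<theta> where \<theta>: "x = norm x *\<^sub>R dir \<theta>" using polar_cases .
  show ?thesis
  proof (cases "x = 0")
    case False
    define r where "r = norm x"
    have r: "r > 0" and x: "polar (vector [\<theta>, r]) = x"
      using False \<theta> by (simp_all add: r_def polar_eq)
    define J where "J = jacobian polar (at (vector [\<theta>, r]))"
    let ?v = "g x *v dir \<theta>"
    have "(transpose J ** g x ** J) $ 1 $ 2 = 0" "(transpose J ** g x ** J) $ 2 $ 2 = 1"
      using pullback_components[OF r, of \<theta>] by (simp_all add: pullback_metric_def J_def x)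
    then have 1: "r * (- sin \<theta> * ?v $ 1 + cos \<theta> * ?v $ 2) = 0"
      and 2: "cos \<theta> * ?v $ 1 + sin \<theta> * ?v $ 2 = 1"
      by (simp_all add: J_def jacobian_polar matrix_matrix_mult_def matrix_vector_mult_def
          transpose_def sum_2 algebra_simps)
    from 1 r have 3: "sin \<theta> * ?v $ 1 = cos \<theta> * ?v $ 2" by simp
    have s: "(sin \<theta>)\<^sup>2 + (cos \<theta>)\<^sup>2 = 1" by simp
    have "?v $ 1 = cos \<theta>" "?v $ 2 = sin \<theta>" using 2 3 s by algebra+
    then have "?v = dir \<theta>" by (simp add: vec_eq_iff forall_2)
    then show ?thesis using \<theta> by (metis matrix_vector_mult_scaleR)
  qed simp
qed

lemma det_pos: "det (g x) > 0"
proof -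
  let ?a = "g x $ 1 $ 1" and ?b = "g x $ 1 $ 2" and ?c = "g x $ 2 $ 2"
  have "(axis 1 1 :: real^2) \<noteq> 0" by (simp add: axis_eq_0_iff)
  from positive[OF this, of x] have a: "?a > 0"
    by (simp add: inner_2 matrix_vector_mult_def sum_2 axis_def)
  \<comment> \<open>On this vector the quadratic form takes the value ?a * det (g x).\<close>
  have "(vector [?b, - ?a] :: real^2) \<noteq> 0" using a by (simp add: vec_eq_iff forall_2 del: not_all)
  from positive[OF this, of x] have "?a * (?a * ?c - ?b * ?b) > 0"
    by (simp add: inner_2 matrix_vector_mult_def sum_2 symmetric algebra_simps)
  then show ?thesis using a by (simp add: det_2 symmetric zero_less_mult_iff)
qed

text \<open>Comparison of determinants in the pullback formula; the Jacobian determinant in the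
  order (\<theta>, r) is - r. All regularity of \<phi>^2 is drawn from this identity, since \<phi>
  itself is an arbitrary function.\<close>

lemma phi_squared: "r > 0 \<Longrightarrow> (\<phi> \<theta> r)\<^sup>2 = r\<^sup>2 * det (g (polar (vector [\<theta>, r])))"
proof -
  assume r: "r > 0"
  let ?J = "jacobian polar (at (vector [\<theta>, r]))"
  have "det (pullback_metric polar g (vector [\<theta>, r])) = (\<phi> \<theta> r)\<^sup>2"
    by (simp add: det_2 pullback_components[OF r])
  moreover have "det (pullback_metric polar g (vector [\<theta>, r])) = (det ?J)\<^sup>2 * det (g (polar (vector [\<theta>, r])))"
    by (simp add: pullback_metric_def det_mul power2_eq_square)
  moreover have "det ?J = - r"
  proof -
    have "det ?J = - (r * (cos \<theta> * cos \<theta>) + r * (sin \<theta> * sin \<theta>))"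
      unfolding jacobian_polar by (simp add: det_2)
    then show ?thesis unfolding distrib_left[symmetric] by simp
  qed
  ultimately show ?thesis by simp
qed

lemma C_k_det: "C_k k (\<lambda>x. det (g x))"
proof -
  have "C_k k (\<lambda>x. g x $ i $ j)" for i j
    using metric
    by (intro C_k_bounded_linear[OF bounded_linear_compose[OF bounded_linear_vec_nth bounded_linear_vec_nth]])
      (simp add: riemannian_metric_def smooth_def)
  then show ?thesis unfolding det_2 by (intro C_k_diff C_k_mult)
qed

text \<open>The logarithmic derivative \<open>\<phi>\<^sub>r / \<phi>\<close>, since \<open>\<phi>\<^sup>2 = r\<^sup>2 det g\<close>.\<close>

definition log_deriv :: "real \<Rightarrow> real \<Rightarrow> real" where
  "log_deriv \<theta> r = 1 / r +
     frechet_derivative (\<lambda>x. det (g x)) (at (r *\<^sub>R dir \<theta>)) (dir \<theta>) / (2 * det (g (r *\<^sub>R dir \<theta>)))"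

text \<open>Frechet derivatives are local, so f may be replaced by any function that agrees with it
  near y. The pulled-back metric has its explicit coefficients only on the open set r > 0.\<close>

lemma partial_eq:
  assumes "open U" "y \<in> U" "\<And>z. z \<in> U \<Longrightarrow> f z = f' z" "(f' has_derivative F) (at y)"
  shows "partial i f y = F (axis i 1)"
proof -
  have "(f has_derivative F) (at y)"
    by (rule has_derivative_transform_within_open[OF assms(4,1,2)]) (use assms(3) in auto)
  then show ?thesis using frechet_derivative_at unfolding partial_def by metis
qed

text \<open>With h = diag (E, 1) and E = \<phi>^2, the Christoffel symbols with both lower indices 2
  vanish and the two mixed ones with upper index 1 equal \<Psi>. The curvature then collapses to -
  \<Psi>_r - \<Psi>^2, which is the classical K = - \<phi>_rr / \<phi>.\<close>

lemma log_deriv_riccati: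
  assumes r: "r > 0"
  shows "(log_deriv \<theta> has_real_derivative - polar_curvature g \<theta> r - (log_deriv \<theta> r)\<^sup>2) (at r)"
proof -
  let ?D = "\<lambda>x. det (g x)"
  obtain dD where dD: "\<And>x. GDERIV ?D x :> dD x" "\<And>v. C_k 1 (\<lambda>x. dD x \<bullet> v)"
    using C_k_gradient[of 1 ?D] C_k_det[of "Suc 1"] by metis
  have fD: "frechet_derivative ?D (at x) h = h \<bullet> dD x" for x h
    using frechet_derivative_at[OF dD(1)[unfolded gderiv_def]] by metis
  define U where "U = {y::real^2. y $ 2 > 0}"
  have U: "open U" unfolding U_def by (intro open_Collect_less continuous_intros)
  define h where "h = pullback_metric polar g"
  define E where "E y = (y $ 2)\<^sup>2 * ?D (polar y)" for y
  define \<Psi> where "\<Psi> y = log_deriv (y $ 1) (y $ 2)" for y :: "real^2"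
  have yv: "vector [y $ 1, y $ 2] = y" for y :: "real^2" by (simp add: vec_eq_iff forall_2)
  have h: "h y $ 1 $ 1 = E y" "h y $ 1 $ 2 = 0" "h y $ 2 $ 1 = 0" "h y $ 2 $ 2 = 1" if "y \<in> U" for y
    using pullback_components[of "y $ 2" "y $ 1"] phi_squared[of "y $ 2" "y $ 1"] that
    by (simp_all add: h_def E_def U_def yv)
  have E_pos: "E y > 0" if "y \<in> U" for y
    using that det_pos by (simp add: E_def U_def)
  have inv: "matrix_inv (h y) $ 1 $ 1 = 1 / E y" if y: "y \<in> U" for y
  proof -
    have "h y ** vector [vector [1 / E y, 0], vector [0, 1]] = mat 1"
      "vector [vector [1 / E y, 0], vector [0, 1]] ** h y = mat 1"
      using h[OF y] E_pos[OF y]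
      by (simp_all add: vec_eq_iff forall_2 matrix_matrix_mult_def sum_2 mat_def)
    then have "matrix_inv (h y) = vector [vector [1 / E y, 0], vector [0, 1]]"
      by (rule matrix_inv_unique)
    then show ?thesis by simp
  qed
  have p0: "partial i (\<lambda>z. h z $ j $ l) y = 0" if "y \<in> U" "j = 2 \<or> l = 2" for i j l y
  proof -
    have "h z $ j $ l = (if j = l then 1 else 0)" if "z \<in> U" for z
      using h[OF that] \<open>j = 2 \<or> l = 2\<close> exhaust_2[of j] exhaust_2[of l] by auto
    then show ?thesis by (rule partial_eq[OF U that(1) _ has_derivative_const])
  qed
  have pE: "partial 2 (\<lambda>z. h z $ 1 $ 1) y = 2 * E y * \<Psi> y" if y: "y \<in> U" for y
  proof -
    have "((\<lambda>x. ?D (polar x)) has_derivative (\<lambda>k. ((k $ 2 * cos (y $ 1) - y $ 2 * sin (y $ 1) * k $ 1) *\<^sub>R axis 1 1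
     + (k $ 2 * sin (y $ 1) + y $ 2 * cos (y $ 1) * k $ 1) *\<^sub>R axis 2 1) \<bullet> dD (polar y))) (at y)"
      by (rule has_derivative_compose[OF polar_has_derivative dD(1)[unfolded gderiv_def]])
    then have "(E has_derivative (\<lambda>k. (y $ 2)\<^sup>2 * (((k $ 2 * cos (y $ 1) - y $ 2 * sin (y $ 1) * k $ 1) *\<^sub>R axis 1 1
     + (k $ 2 * sin (y $ 1) + y $ 2 * cos (y $ 1) * k $ 1) *\<^sub>R axis 2 1) \<bullet> dD (polar y))
     + 2 * y $ 2 * k $ 2 * ?D (polar y))) (at y)"
      unfolding E_def by (auto intro!: derivative_eq_intros bounded_linear.has_derivative[OF bounded_linear_vec_nth])
    from partial_eq[OF U y h(1) this, of 2]
    have "partial 2 (\<lambda>z. h z $ 1 $ 1) y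
        = (y $ 2)\<^sup>2 * (dir (y $ 1) \<bullet> dD (polar y)) + 2 * y $ 2 * ?D (polar y)"
      by (simp add: inner_2 axis_def)
    also have "\<dots> = 2 * E y * \<Psi> y"
      using y det_pos[of "polar y"] unfolding E_def \<Psi>_def log_deriv_def fD polar_eq[symmetric] yv
      by (simp add: U_def field_simps power2_eq_square)
    finally show ?thesis .
  qed
  have c0: "christoffel h 1 2 2 y = 0" "christoffel h 2 2 2 y = 0" if "y \<in> U" for y
    using p0[OF that] by (simp_all add: christoffel_def sum_2)
  have c1: "christoffel h 1 1 2 y = \<Psi> y" "christoffel h 1 2 1 y = \<Psi> y" if "y \<in> U" for y
    using p0[OF that] pE[OF that] inv[OF that] E_pos[OF that] by (simp_all add: christoffel_def sum_2)
  define y0 :: "real^2" where "y0 = vector [\<theta>, r]"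
  have y0: "y0 \<in> U" using r by (simp add: y0_def U_def)
  \<comment> \<open>\<open>partial\<close> is read off a Frechet derivative, so differentiability in
    both coordinates is required, not only along the ray. It follows from det g being C^2.\<close>
  have "\<Psi> differentiable (at y0)"
  proof -
    have "(\<lambda>x. dD x \<bullet> v) differentiable (at x)" for v x
      using dD(2)[of v] by simp
    then have d1: "(\<lambda>y. dD (polar y) \<bullet> v) differentiable (at y0)" for v
      using differentiable_chain_at[of polar y0 "\<lambda>x. dD x \<bullet> v"] polar_has_derivative[of y0]
      by (auto simp: o_def differentiable_def)
    have "?D differentiable (at x)" for x
      using dD(1)[of x] unfolding gderiv_def differentiable_def by blast
    then have d2: "(\<lambda>y. ?D (polar y)) differentiable (at y0)"
      using differentiable_chain_at[of polar y0 ?D] polar_has_derivative[of y0]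
      by (auto simp: o_def differentiable_def)
    have d3: "(\<lambda>y. y $ i) differentiable (at y0)" for i
      using bounded_linear_imp_differentiable[OF bounded_linear_vec_nth] .
    have d4: "(\<lambda>y. cos (y $ 1)) differentiable (at y0)" "(\<lambda>y. sin (y $ 1)) differentiable (at y0)"
      using d3[of 1] has_derivative_cos has_derivative_sin unfolding differentiable_def by blast+
    have "\<Psi> = (\<lambda>y. 1 / y $ 2 + (cos (y $ 1) * (dD (polar y) \<bullet> axis 1 1)
        + sin (y $ 1) * (dD (polar y) \<bullet> axis 2 1)) / (2 * ?D (polar y)))"
      unfolding \<Psi>_def log_deriv_def fD polar_eq[symmetric] yv by (auto simp: inner_2 axis_def)
    then show ?thesis
      using y0 det_pos[of "polar y0"]
      by (auto simp: U_def intro!: derivative_intros d1 d2 d3 d4)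
  qed
  then obtain d where d: "(\<Psi> has_derivative d) (at y0)" unfolding differentiable_def by blast
  have "polar_curvature g \<theta> r = riem_curv h 1 2 1 2 y0"
    using h[OF y0] E_pos[OF y0]
    by (simp add: polar_curvature_def gauss_curvature_def sum_2 det_2 flip: h_def y0_def)
  also have "\<dots> = 0 - d (axis 2 1) - (\<Psi> y0)\<^sup>2"
  proof -
    have "partial 1 (christoffel h 1 2 2) y0 = 0"
      by (rule partial_eq[OF U y0 c0(1) has_derivative_const])
    moreover have "partial 2 (christoffel h 1 1 2) y0 = d (axis 2 1)"
      by (rule partial_eq[OF U y0 c1(1) d])
    ultimately show ?thesis
      using c0[OF y0] c1[OF y0] by (simp add: riem_curv_def sum_2 power2_eq_square)
  qed
  finally have K: "d (axis 2 1) = - polar_curvature g \<theta> r - (log_deriv \<theta> r)\<^sup>2"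
    by (simp add: \<Psi>_def y0_def)
  have v: "vector [\<theta>, s] = \<theta> *\<^sub>R axis 1 1 + s *\<^sub>R (axis 2 1 :: real^2)" for s
    by (simp add: vec_eq_iff forall_2 axis_def)
  have "((\<lambda>s. vector [\<theta>, s] :: real^2) has_derivative (\<lambda>k. k *\<^sub>R axis 2 1)) (at r)"
    unfolding v by (auto intro!: derivative_eq_intros)
  then have "((\<lambda>s. \<Psi> (vector [\<theta>, s])) has_derivative (\<lambda>k. d (k *\<^sub>R axis 2 1))) (at r)"
    by (rule has_derivative_compose) (use d in \<open>simp add: y0_def\<close>)
  moreover have "d (k *\<^sub>R axis 2 1) = k * d (axis 2 1)" for k
    using linear_cmul[OF has_derivative_linear[OF d]] by simp
  ultimately show ?thesis
    by (simp add: has_field_derivative_def \<Psi>_def K mult_commute_abs)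
qed

end

section \<open>Riccati comparison and the radial barrier\<close>

text \<open>After the last time t at which y is at most c = max (y a) 0, the function stays above c
  and hence positive, so y' \<le> 0 there and the mean value theorem gives y b \<le> y t.\<close>

lemma le_max_0_if_nonincreasing_where_positive:
  fixes y :: "real \<Rightarrow> real"
  assumes "a \<le> b" and der: "\<And>t. t \<in> {a..b} \<Longrightarrow> (y has_real_derivative y' t) (at t)"
    and neg: "\<And>t. t \<in> {a..b} \<Longrightarrow> y t > 0 \<Longrightarrow> y' t \<le> 0"
  shows "y b \<le> max (y a) 0"
proof (rule ccontr)
  define c where "c = max (y a) 0"
  assume "\<not> y b \<le> max (y a) 0"
  then have yb: "y b > c" unfolding c_def by linarith
  have cont: "continuous_on {a..b} y"
    by (rule DERIV_continuous_on[of _ _ y']) (use der in \<open>blast intro: has_field_derivative_at_within\<close>)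
  define S where "S = {a..b} \<inter> y -` {..c}"
  have "closed S" unfolding S_def by (rule continuous_closed_preimage[OF cont]) auto
  moreover have S: "a \<in> S" "bdd_above S" using assms(1) by (auto simp: S_def c_def)
  ultimately have t: "Sup S \<in> S" using closed_contains_Sup[of S] by auto
  define t where "t = Sup S"
  have t1: "t \<in> {a..b}" "y t \<le> c" using t by (auto simp: S_def t_def)
  have gt: "y s > c" if "s \<in> {t<..b}" for s
  proof (rule ccontr)
    assume "\<not> y s > c"
    then have "s \<in> S" using that t1 by (auto simp: S_def)
    then have "s \<le> t" unfolding t_def using S(2) by (rule cSup_upper)
    then show False using that by auto
  qed
  have "t < b" using t1 yb by (cases "t = b") auto
  have "\<exists>z>t. z < b \<and> y b - y t = (b - t) * y' z"
    by (rule MVT2[OF \<open>t < b\<close>]) (use der t1 in auto)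
  then obtain z where z: "t < z" "z < b" "y b - y t = (b - t) * y' z" by blast
  have "y' z \<le> 0" using gt[of z] z t1 neg[of z] by (auto simp: c_def)
  then have "y b \<le> y t" using z by (smt (verit) mult_nonneg_nonpos)
  then show False using t1 yb by simp
qed

text \<open>Here h is the logarithmic derivative of (r ln r)^(p-1). The weight r^2 strengthens plain
  comparison: it gives an excess of \<psi> over h of order 1 / r^2, whose integral is finite. At
  each radius either curvature bound may be the one that holds.\<close>

lemma riccati_comparison:
  fixes \<psi> K :: "real \<Rightarrow> real" and p R :: real
  defines "h \<equiv> \<lambda>r. (p - 1) * (1 / r + 1 / (r * ln r))"
  assumes p: "p \<ge> 2" and R: "R \<ge> exp 1" "R \<le> r"
    and der: "\<And>r. r \<ge> R \<Longrightarrow> (\<psi> has_real_derivative - K r - (\<psi> r)\<^sup>2) (at r)"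
    and K: "\<And>r. r \<ge> R \<Longrightarrow> K r \<ge> - ((p - 1) / (r\<^sup>2 * ln r)) \<or> K r \<ge> - ((p - 1) * (p - 2) / r\<^sup>2)"
  shows "r\<^sup>2 * (\<psi> r - h r) \<le> max (R\<^sup>2 * (\<psi> R - h R)) 0"
proof -
  define h' where "h' r = (p - 1) * (- 1 / r\<^sup>2 - (ln r + 1) / (r * ln r)\<^sup>2)" for r
  show ?thesis
  proof (rule le_max_0_if_nonincreasing_where_positive[OF R(2)])
    fix t assume t: "t \<in> {R..r}"
    have tR: "t \<ge> R" using t by simp
    have t0: "t > 0" using tR R(1) by (smt (verit) exp_gt_zero)
    define L where "L = ln t"
    have L: "L \<ge> 1" using tR R(1) t0 by (simp add: L_def ln_ge_iff)
    have dh: "(h has_real_derivative h' t) (at t)"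
    proof -
      have "((\<lambda>r. 1 / r) has_real_derivative - 1 / t\<^sup>2) (at t)"
        using t0 by (auto intro!: derivative_eq_intros simp: power2_eq_square)
      moreover have "((\<lambda>r. 1 / (r * ln r)) has_real_derivative - ((ln t + 1) / (t * ln t)\<^sup>2)) (at t)"
        using t0 L unfolding L_def
        by (auto intro!: derivative_eq_intros simp: power2_eq_square)
          (simp only: minus_divide_left minus_add_distrib diff_conv_add_uminus)
      ultimately show ?thesis
        unfolding h_def h'_def diff_conv_add_uminus by (intro DERIV_cmult DERIV_add)
    qed
    show "((\<lambda>r. r\<^sup>2 * (\<psi> r - h r)) has_real_derivative
        2 * t * (\<psi> t - h t) + t\<^sup>2 * (- K t - (\<psi> t)\<^sup>2 - h' t)) (at t)"
      by (auto intro!: derivative_eq_intros der[OF tR] dh)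
    assume "t\<^sup>2 * (\<psi> t - h t) > 0"
    then have w: "\<psi> t - h t > 0" using t0 by (simp add: zero_less_mult_iff)
    \<comment> \<open>The middle term alone dominates the logarithmic curvature bound, because 2 p -
      3 \<ge> 1, and the first term alone is the other bound.\<close>
    have "h' t + (h t)\<^sup>2 = (p - 1) / t\<^sup>2 * ((p - 2) + (2 * p - 3) / L + (p - 2) / L\<^sup>2)"
      unfolding h_def h'_def L_def[symmetric] using t0 L
      by (simp add: power2_eq_square field_simps)
    moreover have "t\<^sup>2 * ((p - 1) / t\<^sup>2 * X) = (p - 1) * X" for X using t0 by simp
    ultimately have 1: "t\<^sup>2 * (h' t + (h t)\<^sup>2) = (p - 1) * ((p - 2) + (2 * p - 3) / L + (p - 2) / L\<^sup>2)"
      by metis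
    have pos: "(p - 2) / L\<^sup>2 \<ge> 0" "(2 * p - 3) / L \<ge> 1 / L" "1 / L \<ge> 0" using p L
      by (auto intro: divide_right_mono)
    have "t\<^sup>2 * - K t \<le> (p - 1) * ((p - 2) + (2 * p - 3) / L + (p - 2) / L\<^sup>2)"
      using K[OF tR]
    proof
      assume "K t \<ge> - ((p - 1) / (t\<^sup>2 * ln t))"
      then have "t\<^sup>2 * - K t \<le> t\<^sup>2 * ((p - 1) / (t\<^sup>2 * L))"
        by (intro mult_left_mono) (auto simp: L_def)
      also have "\<dots> = (p - 1) * (1 / L)" using t0 by simp
      also have "\<dots> \<le> (p - 1) * ((p - 2) + (2 * p - 3) / L + (p - 2) / L\<^sup>2)"
        using pos p by (intro mult_left_mono; linarith)
      finally show ?thesis .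
    next
      assume "K t \<ge> - ((p - 1) * (p - 2) / t\<^sup>2)"
      then have "t\<^sup>2 * - K t \<le> t\<^sup>2 * ((p - 1) * (p - 2) / t\<^sup>2)"
        by (intro mult_left_mono) auto
      also have "\<dots> = (p - 1) * (p - 2)" using t0 by simp
      also have "\<dots> \<le> (p - 1) * ((p - 2) + (2 * p - 3) / L + (p - 2) / L\<^sup>2)"
        using pos p by (intro mult_left_mono; linarith)
      finally show ?thesis .
    qed
    with 1 have "t\<^sup>2 * - K t \<le> t\<^sup>2 * (h' t + (h t)\<^sup>2)" by simp
    then have 2: "2 * t * (\<psi> t - h t) + t\<^sup>2 * (- K t - (\<psi> t)\<^sup>2 - h' t)
        \<le> 2 * t * (\<psi> t - h t) + t\<^sup>2 * ((h t)\<^sup>2 - (\<psi> t)\<^sup>2)"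
      by (simp add: algebra_simps)
    \<comment> \<open>The term 2 t (\<psi> - h) produced by the weight is absorbed by the cross term
      of h^2 - \<psi>^2; this takes t * h t \<ge> 1.\<close>
    have "t * h t = (p - 1) * (1 + 1 / L)"
      unfolding h_def L_def[symmetric] using t0 L by (simp add: field_simps)
    also have "\<dots> \<ge> 1 * 1" using p L by (intro mult_mono) auto
    finally have th: "t * h t \<ge> 1" by simp
    have "2 * t * (\<psi> t - h t) + t\<^sup>2 * ((h t)\<^sup>2 - (\<psi> t)\<^sup>2)
        = - (t * (\<psi> t - h t))\<^sup>2 - 2 * t * (\<psi> t - h t) * (t * h t - 1)"
      by (simp add: power2_eq_square algebra_simps)
    also have "\<dots> \<le> 0" using t0 w th
      by (smt (verit) mult_nonneg_nonneg zero_le_power2)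
    finally show "2 * t * (\<psi> t - h t) + t\<^sup>2 * (- K t - (\<psi> t)\<^sup>2 - h' t) \<le> 0" using 2 by linarith
  qed
qed

section \<open>The squared positive part and the radial barrier\<close>

definition pos_sq :: "real \<Rightarrow> real" where "pos_sq t = (max 0 t)\<^sup>2"

text \<open>Squaring removes the corner of the positive part: at 0 the difference quotient is max 0
  y, so the result is C^1 and can enter a test function.\<close>

lemma DERIV_pos_sq: "(pos_sq has_real_derivative 2 * max 0 t) (at t)"
proof (cases t "0::real" rule: linorder_cases)
  case less
  have "(pos_sq has_real_derivative 0) (at t)"
    by (rule has_field_derivative_transform_within_open[OF DERIV_const, where S = "{..<0}"])
      (use less in \<open>auto simp: pos_sq_def\<close>)
  then show ?thesis using less by simp
next
  case greater
  have "((\<lambda>t. t\<^sup>2) has_real_derivative 2 * t) (at t)" by (auto intro!: derivative_eq_intros)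
  then have "(pos_sq has_real_derivative 2 * t) (at t)"
    by (rule has_field_derivative_transform_within_open[where S = "{0<..}"])
      (use greater in \<open>auto simp: pos_sq_def\<close>)
  then show ?thesis using greater by simp
next
  case equal
  have "((\<lambda>y. max 0 y) \<longlongrightarrow> max 0 0) (at (0::real))" by (intro tendsto_intros)
  moreover have "\<forall>\<^sub>F y in at 0. max 0 y = (pos_sq y - pos_sq 0) / (y - 0)"
    by (auto simp: eventually_at_filter pos_sq_def power2_eq_square max_def)
  ultimately have "((\<lambda>y. (pos_sq y - pos_sq 0) / (y - 0)) \<longlongrightarrow> 0) (at 0)"
    using Lim_transform_eventually by fastforce
  then show ?thesis using equal by (simp add: has_field_derivative_iff)
qed

lemma pos_sq_nonneg: "pos_sq t \<ge> 0" by (simp add: pos_sq_def)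

lemma pos_sq_mono: "s \<le> t \<Longrightarrow> pos_sq s \<le> pos_sq t"
  by (auto simp: pos_sq_def intro!: power_mono)

lemma continuous_pos_sq: "continuous_on S f \<Longrightarrow> continuous_on S (\<lambda>x. pos_sq (f x))"
  unfolding pos_sq_def by (intro continuous_intros)

text \<open>The barrier is f, with k = f'. The vector field Q(|x|) x is its p-flux k^(p-1) x / |x|,
  and r Q' + Q (r \<psi> + 1) is the divergence of that field for a metric with \<phi>_r / \<phi> =
  \<psi>. The divergence is at most 0 beyond R + 1 and at most \<beta> on the collar where f is
  switched on.\<close>

lemma radial_barrier:
  fixes p C R :: real
  defines "h \<equiv> \<lambda>r. (p - 1) * (1 / r + 1 / (r * ln r))"
  assumes p: "p \<ge> 2" and C: "C \<ge> 0" and R: "R \<ge> exp 1"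
  obtains f k Q Q' :: "real \<Rightarrow> real" and \<beta> where
    "\<And>r. (f has_real_derivative k r) (at r)" "continuous_on UNIV k" "\<And>r. k r \<ge> 0"
    "\<And>r. r \<le> R \<Longrightarrow> k r = 0" "\<And>r. r \<le> R \<Longrightarrow> f r = 0" "\<And>r. f r \<ge> 0"
    "\<And>r. r \<ge> R + 1 \<Longrightarrow> f r \<ge> ln (ln r) - ln (ln (R + 1))"
    "\<And>r. (Q has_real_derivative Q' r) (at r)" "continuous_on UNIV Q'"
    "\<And>r. r \<le> R \<Longrightarrow> Q r = 0" "\<And>r. r \<le> R \<Longrightarrow> Q' r = 0"
    "\<And>r. r * Q r = k r powr (p - 1)" "\<beta> \<ge> 0"
    "\<And>r \<psi>. r \<ge> R \<Longrightarrow> r\<^sup>2 * (\<psi> - h r) \<le> C \<Longrightarrow>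
       r * Q' r + Q r * (r * \<psi> + 1) \<le> (if r \<le> R + 1 then \<beta> else 0)"
proof -
  have R1: "R > 1" using R by (smt (verit) exp_gt_one)
  \<comment> \<open>A C^1 switch from 0 at R to 1 at R + 1, built from two nested squared positive
    parts.\<close>
  define \<kappa> where "\<kappa> r = 1 - pos_sq (1 - pos_sq (r - R))" for r
  define \<kappa>' where "\<kappa>' r = 4 * max 0 (1 - pos_sq (r - R)) * max 0 (r - R)" for r
  have d\<kappa>: "(\<kappa> has_real_derivative \<kappa>' r) (at r)" for r
  proof -
    have 1: "((\<lambda>r. 1 - pos_sq (r - R)) has_real_derivative - (2 * max 0 (r - R))) (at r)"
      using DERIV_chain2[OF DERIV_pos_sq, of "\<lambda>r. r - R" 1 r UNIV]
      by (auto intro!: derivative_eq_intros DERIV_chain2[OF DERIV_pos_sq])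
    show ?thesis unfolding \<kappa>_def \<kappa>'_def
      using DERIV_chain2[OF DERIV_pos_sq 1] by (auto intro!: derivative_eq_intros)
  qed
  have \<kappa>'c: "continuous_on S \<kappa>'" for S unfolding \<kappa>'_def by (intro continuous_intros continuous_pos_sq)
  have \<kappa>c: "continuous_on S \<kappa>" for S unfolding \<kappa>_def by (intro continuous_intros continuous_pos_sq)
  have \<kappa>0: "\<kappa> r = 0" "\<kappa>' r = 0" if "r \<le> R" for r using that by (auto simp: \<kappa>_def \<kappa>'_def pos_sq_def)
  have sq1: "pos_sq (r - R) \<ge> 1" if "r \<ge> R + 1" for r
    using that pos_sq_mono[of 1 "r - R"] by (simp add: pos_sq_def)
  have \<kappa>1: "\<kappa> r = 1" "\<kappa>' r = 0" if "r \<ge> R + 1" for r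
    using sq1[OF that] by (auto simp: \<kappa>_def \<kappa>'_def pos_sq_def[of "1 - _"])
  have \<kappa>_nonneg: "\<kappa> r \<ge> 0" for r
    using pos_sq_mono[of "1 - pos_sq (r - R)" 1] pos_sq_nonneg[of "r - R"]
    by (simp add: \<kappa>_def pos_sq_def[of 1])
  have \<kappa>'_nonneg: "\<kappa>' r \<ge> 0" for r by (simp add: \<kappa>'_def)
  have \<kappa>'_le: "\<kappa>' r \<le> 4" if "r \<le> R + 1" for r
    using that pos_sq_nonneg[of "r - R"] mult_mono[of "max 0 (1 - pos_sq (r - R))" 1 "max 0 (r - R)" 1]
    by (simp add: \<kappa>'_def)
  define a where "a = 1 / (p - 1)"
  have a: "a > 0" "a * (p - 1) = 1" using p by (auto simp: a_def)
  \<comment> \<open>The power a = 1 / (p - 1) makes k^(p-1) linear in \<kappa>. Thus the flux is C^1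
    although k is only shown to be continuous.\<close>
  define k where "k r = (\<kappa> r) powr a * (exp (C * a / r) / (r * ln r))" for r
  have rl: "r * ln r \<ge> 1" "ln r \<ge> 1" "r > 1" if "r \<ge> R" for r
  proof -
    show 1: "r > 1" using that R1 by simp
    show 2: "ln r \<ge> 1" using that R 1 by (simp add: ln_ge_iff)
    show "r * ln r \<ge> 1" using mult_mono[of 1 r 1 "ln r"] 1 2 by simp
  qed
  have k0: "k r = 0" if "r \<le> R" for r using \<kappa>0[OF that] by (simp add: k_def)
  have k_nonneg: "k r \<ge> 0" for r
  proof (cases "r \<le> R")
    case False
    then show ?thesis using rl[of r] by (simp add: k_def)
  qed (simp add: k0)
  have "continuous_on ({..R} \<union> {R..}) (\<lambda>r. if r \<le> R then 0 else k r)"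
  proof (rule continuous_on_If)
    show "continuous_on {R..} k"
      unfolding k_def using rl a \<kappa>_nonneg
      by (intro continuous_intros continuous_on_powr' \<kappa>c) force+
  qed (use k0 in auto)
  moreover have "{..R} \<union> {R..} = UNIV" by auto
  moreover have "(\<lambda>r. if r \<le> R then 0 else k r) = k" using k0 by auto
  ultimately have kc: "continuous_on UNIV k" by metis
  \<comment> \<open>The lower limit 1 lies below R, where k vanishes; for r < 1 the interval is
    empty and f r = 0.\<close>
  define f where "f r = integral {1..r} k" for r
  have f0: "f r = 0" if "r \<le> R" for r
  proof -
    have "f r = integral {1..r} (\<lambda>_. 0)" unfolding f_def
      by (rule integral_cong) (use that k0 in auto)
    then show ?thesis by simp
  qed
  have f_nonneg: "f r \<ge> 0" for r unfolding f_def
    by (rule integral_nonneg) (auto intro!: integrable_continuous_real continuous_on_subset[OF kc] k_nonneg)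
  have df: "(f has_real_derivative k r) (at r)" for r
  proof (cases "r < R")
    case True
    have "(f has_real_derivative 0) (at r)"
      by (rule has_field_derivative_transform_within_open[OF DERIV_const, where S = "{..<R}"])
        (use True f0 in auto)
    then show ?thesis using True k0 by simp
  next
    case False
    then have r: "r \<in> {1<..<r + 1}" using R1 by auto
    have "(f has_real_derivative k r) (at r within {1..r + 1})"
      unfolding f_def
      by (rule integral_has_real_derivative) (use r in \<open>auto intro: continuous_on_subset[OF kc]\<close>)
    then have "(f has_real_derivative k r) (at r within {1<..<r + 1})"
      by (rule DERIV_subset) auto
    then show ?thesis using at_within_open[OF r open_greaterThanLessThan] by simp
  qed
  \<comment> \<open>Beyond R + 1 the switch is fully on and the exponential factor is at least 1, so
    k dominates the derivative 1 / (t ln t) of ln (ln t).\<close>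
  have f_ge: "f r \<ge> ln (ln r) - ln (ln (R + 1))" if r: "r \<ge> R + 1" for r
  proof -
    have "f (R + 1) - ln (ln (R + 1)) \<le> f r - ln (ln r)"
    proof (rule DERIV_nonneg_imp_nondecreasing[OF r])
      fix t assume t: "R + 1 \<le> t" "t \<le> r"
      have t': "t \<ge> R" using t by simp
      have "((\<lambda>t. f t - ln (ln t)) has_real_derivative k t - 1 / (t * ln t)) (at t)"
        using rl[OF t'] by (auto intro!: derivative_eq_intros df simp: field_simps)
      moreover have "k t \<ge> 1 / (t * ln t)"
        using \<kappa>1[OF t(1)] rl[OF t'] C a by (auto simp: k_def intro!: divide_right_mono)
      ultimately show "\<exists>y. ((\<lambda>t. f t - ln (ln t)) has_real_derivative y) (at t) \<and> 0 \<le> y"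
        by (intro exI[of _ "k t - 1 / (t * ln t)"]) auto
    qed
    then show ?thesis using f_nonneg[of "R + 1"] by simp
  qed
  \<comment> \<open>Up to the switch, E is the flux divided by r. Written as one exponential, its
    derivative is E times that of the exponent.\<close>
  define E where "E r = exp (C / r - (p - 1) * ln (r * ln r) - ln r)" for r
  have rE: "r * E r = exp (C / r) * (r * ln r) powr (1 - p)" if "r \<ge> R" for r
  proof -
    have "C / r - (p - 1) * ln (r * ln r) - ln r = C / r + (1 - p) * ln (r * ln r) + - ln r"
      by (simp add: algebra_simps)
    then have "E r = exp (C / r) * exp ((1 - p) * ln (r * ln r)) * exp (- ln r)"
      by (simp only: E_def exp_add)
    then show ?thesis using rl[OF that] by (simp add: powr_def exp_minus)
  qed
  define E' where "E' r = - E r * (C / r\<^sup>2 + h r + 1 / r)" for r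
  have dE: "(E has_real_derivative E' r) (at r)" if "r \<ge> R" for r
  proof -
    note rl = rl[OF that]
    have "((\<lambda>r. C / r - (p - 1) * ln (r * ln r) - ln r) has_real_derivative
        - C / r\<^sup>2 - (p - 1) * ((1 * ln r + r * (1 / r)) / (r * ln r)) - 1 / r) (at r)"
      using rl by (auto intro!: derivative_eq_intros simp: power2_eq_square)
    moreover have "- C / r\<^sup>2 - (p - 1) * ((1 * ln r + r * (1 / r)) / (r * ln r)) - 1 / r
        = - (C / r\<^sup>2 + h r + 1 / r)"
      using rl by (simp add: h_def add_divide_distrib algebra_simps)
    ultimately have "((\<lambda>r. C / r - (p - 1) * ln (r * ln r) - ln r) has_real_derivative
        - (C / r\<^sup>2 + h r + 1 / r)) (at r)" by metis
    from DERIV_fun_exp[OF this] show ?thesis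
      unfolding E'_def E_def [abs_def] by (simp only: mult_minus_left mult_minus_right)
  qed
  define Q where "Q r = \<kappa> r * E r" for r
  define Q' where "Q' r = \<kappa>' r * E r + \<kappa> r * E' r" for r
  have Q0: "Q r = 0" "Q' r = 0" if "r \<le> R" for r using \<kappa>0[OF that] by (auto simp: Q_def Q'_def)
  have dQ: "(Q has_real_derivative Q' r) (at r)" for r
  proof (cases "r < R")
    case True
    have "(Q has_real_derivative 0) (at r)"
      by (rule has_field_derivative_transform_within_open[OF DERIV_const, where S = "{..<R}"])
        (use True Q0 in auto)
    then show ?thesis using True Q0 by simp
  next
    case False
    then show ?thesis unfolding Q_def [abs_def] Q'_def
      by (auto intro!: derivative_eq_intros d\<kappa> dE)
  qed
  have "continuous_on ({..R} \<union> {R..}) (\<lambda>r. if r \<le> R then 0 else Q' r)"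
  proof (rule continuous_on_If)
    have Ec: "continuous_on {R..} E"
      by (rule DERIV_continuous_on) (use dE in \<open>auto intro: has_field_derivative_at_within\<close>)
    show "continuous_on {R..} Q'"
      unfolding Q'_def E'_def h_def using rl 
      by (intro continuous_intros \<kappa>c \<kappa>'c Ec) force+
  qed (use Q0 in auto)
  moreover have "{..R} \<union> {R..} = UNIV" by auto
  moreover have "(\<lambda>r. if r \<le> R then 0 else Q' r) = Q'" using Q0 by auto
  ultimately have Q'c: "continuous_on UNIV Q'" by metis
  have flux: "r * Q r = k r powr (p - 1)" for r
  proof (cases "r \<le> R")
    case False
    then have r: "r \<ge> R" by simp
    note rl = rl[OF r]
    have "k r powr (p - 1) = (\<kappa> r powr a) powr (p - 1) * exp (C * a / r) powr (p - 1)
        / (r * ln r) powr (p - 1)"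
      unfolding k_def using rl by (simp add: powr_mult powr_divide)
    also have "(\<kappa> r powr a) powr (p - 1) = \<kappa> r" using a \<kappa>_nonneg[of r] by (simp add: powr_powr)
    also have "exp (C * a / r) powr (p - 1) = exp (C / r)"
    proof -
      have "C * a / r * (p - 1) = C / r" using a by (simp add: mult.assoc)
      then show ?thesis by (simp add: powr_def mult.commute)
    qed
    also have "\<kappa> r * exp (C / r) / (r * ln r) powr (p - 1) = \<kappa> r * exp (C / r) * (r * ln r) powr (1 - p)"
      using powr_minus_divide[of "r * ln r" "p - 1"] by simp
    finally show ?thesis using rE[OF r] by (simp add: Q_def mult.left_commute mult.assoc)
  qed (simp add: Q0 k0)
  have main: "r * Q' r + Q r * (r * \<psi> + 1) \<le> (if r \<le> R + 1 then 4 * exp C else 0)"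
    if r: "r \<ge> R" and \<psi>: "r\<^sup>2 * (\<psi> - h r) \<le> C" for r \<psi>
  proof -
    note rl = rl[OF r]
    have E0: "E r \<ge> 0" by (simp add: E_def)
    have "\<psi> - h r \<le> C / r\<^sup>2" using \<psi> rl by (simp add: field_simps)
    then have "\<psi> - h r - C / r\<^sup>2 \<le> 0" by simp
    then have neg: "r * \<kappa> r * E r * (\<psi> - h r - C / r\<^sup>2) \<le> 0"
      using rl \<kappa>_nonneg[of r] E0 by (intro mult_nonneg_nonpos) auto
    \<comment> \<open>The divergence splits into a switching term, present only on the collar, and a
      term with the sign of \<psi> - h - C / r^2. The factor exp (C / r) in the flux supplies the C
      / r^2 that makes this sign nonpositive.\<close>
    have "r * Q' r + Q r * (r * \<psi> + 1) = \<kappa>' r * (r * E r) + r * \<kappa> r * E r * (\<psi> - h r - C / r\<^sup>2)"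
      using rl by (simp add: Q_def Q'_def E'_def field_simps)
    also have "\<dots> \<le> \<kappa>' r * (r * E r)" using neg by simp
    also have "\<dots> \<le> (if r \<le> R + 1 then 4 * exp C else 0)"
    proof (cases "r \<le> R + 1")
      case True
      have "r * E r = exp (C / r) * (r * ln r) powr (1 - p)" by (rule rE[OF r])
      also have "\<dots> \<le> exp C * 1"
      proof (rule mult_mono)
        have "C * 1 \<le> C * r" using rl C by (intro mult_left_mono) auto
        then show "exp (C / r) \<le> exp C" using rl by (simp add: field_simps)
        show "(r * ln r) powr (1 - p) \<le> 1"
          using rl p powr_mono[of "1 - p" 0 "r * ln r"] by simp
      qed auto
      finally have "r * E r \<le> exp C" by simp
      then show ?thesis using True \<kappa>'_le[OF True] \<kappa>'_nonneg[of r] E0 rl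
        by (auto intro!: mult_mono)
    qed (use \<kappa>1 in auto)
    finally show ?thesis .
  qed
  show thesis
    by (rule that[of f k Q Q' "4 * exp C"])
      (use df kc k_nonneg k0 f0 f_nonneg f_ge dQ Q'c Q0 flux main in auto)
qed

section \<open>The energy estimate\<close>

text \<open>The divergence of the field w a x integrates to zero. It is the sum over the basis of
  the gradients of w a (x . i) paired with i, and the dimension enters as the divergence of
  x.\<close>

lemma integral_radial_by_parts:
  fixes a w :: "'a::euclidean_space \<Rightarrow> real"
  assumes da: "\<And>x. GDERIV a x :> da x" "continuous_on UNIV da"
    and dw: "\<And>x. GDERIV w x :> dw x" "continuous_on UNIV dw"
    and supp: "\<And>x. norm x > R \<Longrightarrow> w x = 0"
  shows "(\<integral>x. a x * (x \<bullet> dw x) \<partial>lborel) = - (\<integral>x. w x * (x \<bullet> da x + DIM('a) * a x) \<partial>lborel)"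
proof -
  have ac: "continuous_on S a" for S using GDERIV_continuous[OF da(1)] .
  have wc: "continuous_on S w" for S using GDERIV_continuous[OF dw(1)] .
  have dw0: "norm x > R \<Longrightarrow> dw x = 0" for x by (rule GDERIV_zero_outside[OF dw(1) supp])
  define dh where "dh i x = (w x * a x) *\<^sub>R i + (x \<bullet> i) *\<^sub>R (w x *\<^sub>R da x + a x *\<^sub>R dw x)" for i x
  have dhc: "continuous_on UNIV (dh i)" for i
    unfolding dh_def by (intro continuous_intros ac wc da dw)
  have 0: "(\<integral>x. i \<bullet> dh i x \<partial>lborel) = 0" for i
  proof (rule integral_gradient_eq_0[OF _ dhc, where R = R])
    fix x
    have "GDERIV (\<lambda>x. x \<bullet> i) x :> i"
      by (auto simp: gderiv_def intro!: derivative_eq_intros)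
    from GDERIV_mult[OF GDERIV_mult[OF dw(1) da(1)] this]
    show "GDERIV (\<lambda>x. w x * a x * (x \<bullet> i)) x :> dh i x" by (simp add: dh_def)
  qed (simp add: supp)
  have int: "integrable lborel (\<lambda>x. i \<bullet> dh i x)" for i
    by (rule compact_support_integrable[of _ R], intro continuous_intros dhc) (simp add: dh_def supp dw0)
  have i1: "integrable lborel (\<lambda>x. a x * (x \<bullet> dw x))"
    by (rule compact_support_integrable[of _ R]) (auto intro!: continuous_intros ac dw simp: dw0)
  have i2: "integrable lborel (\<lambda>x. w x * (x \<bullet> da x + DIM('a) * a x))"
    by (rule compact_support_integrable[of _ R]) (auto intro!: continuous_intros ac wc da simp: supp)
  have "(\<Sum>i\<in>Basis. i \<bullet> dh i x) = a x * (x \<bullet> dw x) + w x * (x \<bullet> da x + DIM('a) * a x)" for x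
  proof -
    have "(\<Sum>i\<in>Basis. i \<bullet> dh i x)
        = (\<Sum>i\<in>Basis. w x * a x + w x * ((x \<bullet> i) * (da x \<bullet> i)) + a x * ((x \<bullet> i) * (dw x \<bullet> i)))"
      by (rule sum.cong) (auto simp: dh_def inner_add_right inner_commute algebra_simps)
    also have "\<dots> = w x * (DIM('a) * a x) + w x * (x \<bullet> da x) + a x * (x \<bullet> dw x)"
      by (simp only: sum.distrib sum_distrib_left[symmetric] sum_constant euclidean_inner[symmetric])
    finally show ?thesis by (simp add: algebra_simps)
  qed
  then have "(\<integral>x. a x * (x \<bullet> dw x) \<partial>lborel) + (\<integral>x. w x * (x \<bullet> da x + DIM('a) * a x) \<partial>lborel)
      = (\<integral>x. (\<Sum>i\<in>Basis. i \<bullet> dh i x) \<partial>lborel)"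
    using i1 i2 by simp
  also have "\<dots> = 0" using int 0 by (simp add: Bochner_Integration.integral_sum)
  finally show ?thesis by simp
qed

lemma GDERIV_radial:
  fixes x :: "'a::real_inner" and F :: "real \<Rightarrow> real"
  assumes "\<And>r. (F has_real_derivative F' r) (at r)" "R > 0" "\<And>r. r \<le> R \<Longrightarrow> F r = 0" "\<And>r. r \<le> R \<Longrightarrow> F' r = 0"
  shows "GDERIV (\<lambda>x. F (norm x)) x :> F' (norm x) *\<^sub>R sgn x"
proof (cases "x = 0")
  case True
  have "GDERIV (\<lambda>x::'a. F (norm x)) x :> 0"
    by (rule GDERIV_transform_open[OF GDERIV_const, of "ball 0 R"]) (use True assms in auto)
  then show ?thesis using True by simp
next
  case False
  show ?thesis by (rule GDERIV_DERIV_compose[OF GDERIV_norm[OF False] assms(1)])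
qed

lemma continuous_radial_gradient:
  fixes F' :: "real \<Rightarrow> real"
  assumes "continuous_on UNIV F'" "R > 0" "\<And>r. r \<le> R \<Longrightarrow> F' r = 0"
  shows "continuous_on UNIV (\<lambda>x::'a::real_inner. F' (norm x) *\<^sub>R sgn x)"
proof -
  \<comment> \<open>Replacing the norm by its maximum with R in the denominator removes the
    singularity at the origin and changes nothing where F' is nonzero.\<close>
  have "continuous_on UNIV (\<lambda>x::'a. (F' (norm x) / max R (norm x)) *\<^sub>R x)"
    using assms(2) by (intro continuous_intros continuous_on_compose2[OF assms(1)]) auto
  moreover have "(F' (norm x) / max R (norm x)) *\<^sub>R x = F' (norm x) *\<^sub>R sgn x" for x :: 'a
    using assms(3)[of "norm x"] by (cases "norm x \<le> R") (auto simp: sgn_div_norm divide_inverse)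
  ultimately show ?thesis by simp
qed

text \<open>Cutting off at the circle creates no jump: z is negative near it, so the squared
  positive part already vanishes there. The plane is covered by the open disc and the open set where
  the cut-off function is identically 0.\<close>

lemma pos_sq_cutoff:
  fixes z :: "'a::euclidean_space \<Rightarrow> real"
  assumes dz: "\<And>x. GDERIV z x :> dz x" "continuous_on UNIV dz"
    and neg: "\<And>x. norm x = \<rho> \<Longrightarrow> z x < 0"
  defines "w \<equiv> \<lambda>x. if norm x < \<rho> then pos_sq (z x) else 0"
    and "dw \<equiv> \<lambda>x. if norm x < \<rho> then (2 * max 0 (z x)) *\<^sub>R dz x else 0"
  shows "GDERIV w x :> dw x" "continuous_on UNIV dw"
proof -
  have zc: "continuous_on S z" for S using GDERIV_continuous[OF dz(1)] .
  define U where "U = {x::'a. norm x < \<rho>}"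
  define V where "V = {x. norm x > \<rho>} \<union> {x. z x < 0}"
  have U: "open U" unfolding U_def by (intro open_Collect_less continuous_intros)
  have V: "open V" unfolding V_def by (intro open_Un open_Collect_less continuous_intros zc)
  have "x \<in> U \<union> V" for x
    using neg[of x] by (cases "norm x" \<rho> rule: linorder_cases) (auto simp: U_def V_def)
  then have UV: "U \<union> V = UNIV" by blast
  have V0: "w y = 0" "dw y = 0" if "y \<in> V" for y
    using that by (auto simp: w_def dw_def V_def pos_sq_def)
  have U1: "w y = pos_sq (z y)" "dw y = (2 * max 0 (z y)) *\<^sub>R dz y" if "y \<in> U" for y
    using that by (auto simp: w_def dw_def U_def)
  show "GDERIV w x :> dw x"
  proof (cases "x \<in> V")
    case True
    have "GDERIV w x :> 0"
      by (rule GDERIV_transform_open[OF GDERIV_const[of 0] V True]) (simp add: V0)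
    then show ?thesis using V0[OF True] by simp
  next
    case False
    then have x: "x \<in> U" using UV by blast
    have "GDERIV w x :> (2 * max 0 (z x)) *\<^sub>R dz x"
      by (rule GDERIV_transform_open[OF GDERIV_DERIV_compose[OF dz(1) DERIV_pos_sq] U x]) (simp add: U1)
    then show ?thesis using U1[OF x] by simp
  qed
  have "continuous_on U (\<lambda>x. (2 * max 0 (z x)) *\<^sub>R dz x)"
    by (intro continuous_intros zc continuous_on_subset[OF dz(2)]) auto
  then have "continuous_on U dw" using U1 by (simp cong: continuous_on_cong)
  moreover have "continuous_on V dw" using V0 by (simp cong: continuous_on_cong)
  ultimately have "continuous_on (U \<union> V) dw" by (intro continuous_on_open_Un U V)
  then show "continuous_on UNIV dw" using UV by simp
qed

section \<open>The p-flux of a function and its energy\<close>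

context polar_metric_on_plane
begin

lemma matrix_inv_metric:
  "matrix_inv (g x) = vector [vector [g x $ 2 $ 2 / det (g x), - g x $ 1 $ 2 / det (g x)],
     vector [- g x $ 1 $ 2 / det (g x), g x $ 1 $ 1 / det (g x)]]" (is "_ = ?B")
proof (rule matrix_inv_unique)
  have d: "det (g x) \<noteq> 0" using det_pos[of x] by simp
  have e: "det (g x) = g x $ 1 $ 1 * g x $ 2 $ 2 - g x $ 1 $ 2 * g x $ 1 $ 2"
    by (simp add: det_2 symmetric)
  show "g x ** ?B = mat 1" "?B ** g x = mat 1"
    using d unfolding e
    by (simp_all add: vec_eq_iff forall_2 matrix_matrix_mult_def sum_2 mat_def symmetric
        add_divide_distrib[symmetric] diff_divide_distrib[symmetric] algebra_simps)
qed

lemma metric_mult_inv: "g x *v (matrix_inv (g x) *v a) = a"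
proof -
  have d: "det (g x) \<noteq> 0" using det_pos[of x] by simp
  have e: "det (g x) = g x $ 1 $ 1 * g x $ 2 $ 2 - g x $ 1 $ 2 * g x $ 1 $ 2"
    by (simp add: det_2 symmetric)
  show ?thesis using d unfolding matrix_inv_metric e
    by (simp add: vec_eq_iff forall_2 matrix_vector_mult_def sum_2 symmetric divide_simps)
      (simp add: algebra_simps)
qed

lemma riem_grad_eq:
  assumes "GDERIV u x :> d"
  shows "riem_grad g u x = matrix_inv (g x) *v d"
proof -
  have "frechet_derivative u (at x) = (\<lambda>h. h \<bullet> d)"
    using frechet_derivative_at assms unfolding gderiv_def by metis
  then have "(\<chi> i. partial i u x) = d"
    by (simp add: partial_def vec_eq_iff inner_axis')
  then show ?thesis by (simp add: riem_grad_def)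
qed

lemma metric_mult_riem_grad: "GDERIV u x :> d \<Longrightarrow> g x *v riem_grad g u x = d"
  by (simp add: riem_grad_eq metric_mult_inv)

lemma continuous_metric: "continuous_on S (\<lambda>x. g x $ i $ j)"
proof -
  have "continuous_on UNIV g" using metric C_k.simps(1) unfolding riemannian_metric_def smooth_def by blast
  then show ?thesis by (intro continuous_intros) (auto intro: continuous_on_subset)
qed

lemma continuous_det: "continuous_on S (\<lambda>x. det (g x))"
  unfolding det_2 by (intro continuous_intros continuous_metric)

lemma metric_inner_commute: "v \<bullet> (g x *v w) = w \<bullet> (g x *v v)"
  by (simp add: inner_2 matrix_vector_mult_def sum_2 symmetric algebra_simps)

lemma riem_norm_squared: "(riem_norm g x v)\<^sup>2 = v \<bullet> (g x *v v)"
  using positive[of v x] by (cases "v = 0") (simp_all add: riem_norm_def riem_inner_def)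

lemma riem_norm_eq_0_iff: "riem_norm g x v = 0 \<longleftrightarrow> v = 0"
  using positive[of v x] by (cases "v = 0") (simp_all add: riem_norm_def riem_inner_def)

lemma riem_norm_nonneg: "riem_norm g x v \<ge> 0"
  using positive[of v x] by (cases "v = 0") (simp_all add: riem_norm_def riem_inner_def)

lemma metric_unit_radial: "x \<noteq> 0 \<Longrightarrow> g x *v sgn x = sgn x"
  by (simp add: sgn_div_norm matrix_vector_mult_scaleR radial)

text \<open>Monotonicity of v |-> |v|^(p-2) v, compared with a nonnegative multiple of the unit
  radial vector e. As \<open>g x\<close> fixes e, Cauchy-Schwarz bounds the radial component s of v
  by its norm N, which reduces the claim to (N^(p-1) - t^(p-1)) (N - t) \<ge> 0.\<close>

lemma p_flux_monotone:
  assumes p: "p \<ge> 2" and x: "x \<noteq> 0" and t: "t \<ge> 0"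
  shows "(riem_norm g x v powr (p - 2) *\<^sub>R v - t powr (p - 1) *\<^sub>R sgn x) \<bullet> (g x *v v - t *\<^sub>R sgn x) \<ge> 0"
proof -
  define e where "e = sgn x"
  define N where "N = riem_norm g x v"
  define s where "s = v \<bullet> e"
  have ee: "e \<bullet> e = 1" using x by (simp add: e_def dot_square_norm norm_sgn)
  have ge: "g x *v e = e" unfolding e_def by (rule metric_unit_radial[OF x])
  have es: "e \<bullet> (g x *v v) = s" using metric_inner_commute[of e x v] ge by (simp add: s_def)
  have NN: "v \<bullet> (g x *v v) = N * N" using riem_norm_squared[of x v] by (simp add: N_def power2_eq_square)
  have N0: "N \<ge> 0" unfolding N_def by (rule riem_norm_nonneg)
  \<comment> \<open>The squared g-length of the part of v orthogonal to e.\<close>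
  have "0 \<le> (v - s *\<^sub>R e) \<bullet> (g x *v (v - s *\<^sub>R e))"
    using riem_norm_squared[of x "v - s *\<^sub>R e"] by (metis zero_le_power2)
  also have "\<dots> = N * N - s * s"
    by (simp add: matrix_vector_mult_diff_distrib matrix_vector_mult_scaleR ge inner_diff_left
        inner_diff_right NN es ee flip: s_def)
  finally have "s\<^sup>2 \<le> N\<^sup>2" by (simp add: power2_eq_square)
  then have s: "s \<le> N" using N0 by (rule power2_le_imp_le)
  have pw: "y powr (p - 2) * y = y powr (p - 1)" if "y \<ge> 0" for y
    using that powr_add[of y "p - 2" 1] by (cases "y = 0") (auto simp: algebra_simps)
  have "0 \<le> (N powr (p - 1) - t powr (p - 1)) * (N - t)"
  proof (cases "N \<le> t")
    case True
    then have "N powr (p - 1) \<le> t powr (p - 1)" using N0 p by (intro powr_mono2) auto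
    then show ?thesis using True by (simp add: mult_nonpos_nonpos)
  next
    case False
    then have "t powr (p - 1) \<le> N powr (p - 1)" using t p by (intro powr_mono2) auto
    then show ?thesis using False by simp
  qed
  also have "\<dots> = N powr (p - 1) * N - t * (N powr (p - 2) * N) - t powr (p - 1) * N + t powr (p - 1) * t"
    using pw[OF N0] by (simp add: algebra_simps)
  also have "\<dots> \<le> N powr (p - 1) * N - t * (N powr (p - 2) * s) - t powr (p - 1) * s + t powr (p - 1) * t"
    using s t by (intro add_right_mono diff_mono mult_left_mono) auto
  also have "\<dots> = (N powr (p - 2) *\<^sub>R v - t powr (p - 1) *\<^sub>R e) \<bullet> (g x *v v - t *\<^sub>R e)"
    using pw[OF N0, symmetric]
    by (simp add: inner_diff_left inner_diff_right NN es ee s_def[symmetric] algebra_simps)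
  finally show ?thesis by (simp add: N_def e_def)
qed

text \<open>The Euclidean inner product of this field with the Euclidean gradient of \<eta> is the
  g-pairing with grad \<eta>, because \<open>g x\<close> cancels the inverse matrix in
  \<open>riem_grad\<close>.\<close>

definition p_flux :: "real \<Rightarrow> (real^2 \<Rightarrow> real) \<Rightarrow> real^2 \<Rightarrow> real^2" where
  "p_flux p u x = riem_norm g x (riem_grad g u x) powr (p - 2) *\<^sub>R riem_grad g u x"

lemma continuous_p_flux:
  assumes p: "p \<ge> 2" and du: "\<And>x. GDERIV u x :> du x" "continuous_on UNIV du"
  shows "continuous_on UNIV (p_flux p u)"
proof -
  have d: "det (g x) \<noteq> 0" for x using det_pos[of x] by simp
  have "riem_grad g u = (\<lambda>x. ((g x $ 2 $ 2 * du x $ 1 - g x $ 1 $ 2 * du x $ 2) / det (g x)) *\<^sub>R axis 1 1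
      + ((g x $ 1 $ 1 * du x $ 2 - g x $ 1 $ 2 * du x $ 1) / det (g x)) *\<^sub>R axis 2 1)"
    by (simp add: fun_eq_iff riem_grad_eq[OF du(1)] matrix_inv_metric vec_eq_iff forall_2
        matrix_vector_mult_def sum_2 axis_def diff_divide_distrib)
  then have gc: "continuous_on UNIV (riem_grad g u)"
    using d by (simp only:) (intro continuous_intros continuous_metric continuous_det du(2), auto)
  have gc': "continuous_on UNIV (\<lambda>x. riem_grad g u x $ i)" for i
    by (intro continuous_intros gc)
  have nc: "continuous_on UNIV (\<lambda>x. riem_norm g x (riem_grad g u x))"
    unfolding riem_norm_def riem_inner_def inner_2 matrix_vector_mult_def
    by (simp add: sum_2, intro continuous_intros gc' continuous_metric)
  show ?thesis
  \<comment> \<open>For p = 2 the factor \<open>powr\<close> jumps to 0 where the gradient vanishes,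
    but the product is still the gradient. For p > 2 the exponent is positive and
    \<open>powr\<close> is continuous up to 0.\<close>
  proof (cases "p = 2")
    case True
    have "p_flux p u = riem_grad g u"
      unfolding p_flux_def True using riem_norm_eq_0_iff by (auto simp: fun_eq_iff)
    then show ?thesis using gc by simp
  next
    case False
    then show ?thesis using p unfolding p_flux_def
      by (intro continuous_on_scaleR gc continuous_on_powr' nc continuous_on_const) (auto intro: riem_norm_nonneg)
  qed
qed

text \<open>The weak inequality rewritten against Lebesgue measure, with the volume density absorbed
  into the field, and extended to compactly supported C^1 test functions.\<close>

lemma p_subharmonic_C1_test:
  assumes p: "p \<ge> 2" and du: "\<And>x. GDERIV u x :> du x" "continuous_on UNIV du"
    and sub: "p_subharmonic g p u"
    and dw: "\<And>x. GDERIV w x :> dw x" "continuous_on UNIV dw"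
    and supp: "\<And>x. norm x > R \<Longrightarrow> w x = 0" and nonneg: "\<And>x. w x \<ge> 0"
  shows "(\<integral>x. (sqrt (det (g x)) *\<^sub>R p_flux p u x) \<bullet> dw x \<partial>lborel) \<le> 0"
proof (rule weak_inequality_C1[OF _ _ dw supp nonneg])
  show "continuous_on UNIV (\<lambda>x. sqrt (det (g x)) *\<^sub>R p_flux p u x)"
    by (intro continuous_intros continuous_det continuous_p_flux[OF p du])
next
  fix \<eta> and d\<eta> :: "real^2 \<Rightarrow> real^2"
  assume \<eta>: "smooth \<eta>" "compact (closure {x. \<eta> x \<noteq> 0})" "\<And>x. \<eta> x \<ge> 0" and d\<eta>: "\<And>x. GDERIV \<eta> x :> d\<eta> x"
  have "C_k (Suc 0) \<eta>" using \<eta>(1) unfolding smooth_def by blast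
  then obtain d\<eta>' where "\<And>x. GDERIV \<eta> x :> d\<eta>' x" "continuous_on UNIV d\<eta>'"
    by (rule C_k_gradient) (rule that)
  then have d\<eta>c: "continuous_on UNIV d\<eta>"
    using GDERIV_unique[OF d\<eta>] by (metis continuous_on_eq)
  have "riem_inner g x (riem_grad g u x) (riem_grad g \<eta> x) = riem_grad g u x \<bullet> d\<eta> x" for x
    using metric_mult_riem_grad[OF d\<eta>] by (simp add: riem_inner_def)
  then have eq: "riem_norm g x (riem_grad g u x) powr (p - 2) * riem_inner g x (riem_grad g u x) (riem_grad g \<eta> x)
      = p_flux p u x \<bullet> d\<eta> x" for x
    by (simp add: p_flux_def)
  have "(\<integral>x. riem_norm g x (riem_grad g u x) powr (p - 2) *
      riem_inner g x (riem_grad g u x) (riem_grad g \<eta> x) \<partial>riem_volume g) \<le> 0"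
    using sub \<eta> unfolding p_subharmonic_def by blast
  then have "(\<integral>x. p_flux p u x \<bullet> d\<eta> x \<partial>riem_volume g) \<le> 0" unfolding eq .
  moreover have "(\<integral>x. p_flux p u x \<bullet> d\<eta> x \<partial>riem_volume g)
      = (\<integral>x. sqrt (det (g x)) *\<^sub>R (p_flux p u x \<bullet> d\<eta> x) \<partial>lborel)"
    unfolding riem_volume_def
  proof (rule integral_density)
    have "(\<lambda>x. p_flux p u x \<bullet> d\<eta> x) \<in> borel_measurable borel"
      by (intro borel_measurable_continuous_onI continuous_intros continuous_p_flux[OF p du] d\<eta>c)
    then show "(\<lambda>x. p_flux p u x \<bullet> d\<eta> x) \<in> borel_measurable lborel" by simp
    have "(\<lambda>x. sqrt (det (g x))) \<in> borel_measurable borel"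
      by (intro borel_measurable_continuous_onI continuous_intros continuous_det)
    then show "(\<lambda>x. sqrt (det (g x))) \<in> borel_measurable lborel" by simp
  qed (use det_pos in \<open>auto intro: less_imp_le\<close>)
  ultimately show "(\<integral>x. (sqrt (det (g x)) *\<^sub>R p_flux p u x) \<bullet> d\<eta> x \<partial>lborel) \<le> 0" by simp
qed

text \<open>Test with w, the squared positive part of u - c - \<tau> f inside the circle of radius
  \<rho>, and subtract the flux of \<tau> f. On the ball of radius R the barrier vanishes and the
  energy of u remains; elsewhere monotonicity gives a nonnegative integrand. The flux of \<tau> f is
  integrated by parts, and only its positive divergence on the collar costs anything.\<close>

lemma energy_bound:
  assumes p: "p \<ge> 2" and du: "\<And>x. GDERIV u x :> du x" "continuous_on UNIV du"
    and sub: "p_subharmonic g p u"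
    and R: "R > 0"
    and f: "\<And>r. (f has_real_derivative k r) (at r)" "continuous_on UNIV k" "\<And>r. k r \<ge> 0"
      "\<And>r. r \<le> R \<Longrightarrow> k r = 0" "\<And>r. r \<le> R \<Longrightarrow> f r = 0" "\<And>r. f r \<ge> 0"
    and Q: "\<And>r. (Q has_real_derivative Q' r) (at r)" "continuous_on UNIV Q'"
      "\<And>r. r \<le> R \<Longrightarrow> Q r = 0" "\<And>r. r \<le> R \<Longrightarrow> Q' r = 0"
      "\<And>r. r * Q r = k r powr (p - 1)" "\<beta> \<ge> 0"
    and div: "\<And>r \<theta>. r \<ge> R \<Longrightarrow>
      r * Q' r + Q r * (r * log_deriv \<theta> r + 1) \<le> (if r \<le> R + 1 then \<beta> else 0)"
    and lam: "\<tau> > 0" and \<rho>: "\<rho> > R + 1" "\<And>x. norm x = \<rho> \<Longrightarrow> u x - c - \<tau> * f \<rho> < 0"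
  shows "(\<integral>x. indicator (cball 0 R) x * (sqrt (det (g x)) * (2 * max 0 (u x - c)) * (p_flux p u x \<bullet> du x)) \<partial>lborel)
    \<le> \<tau> powr (p - 1) * (\<beta> * (\<integral>x. indicator (cball 0 (R + 1)) x * (sqrt (det (g x)) * pos_sq (u x - c)) \<partial>lborel))"
proof -
  define S where "S x = sqrt (det (g x))" for x
  define A where "A = p_flux p u"
  have S: "S x > 0" for x using det_pos[of x] by (simp add: S_def)
  have Sc: "continuous_on T S" for T unfolding S_def by (intro continuous_intros continuous_det)
  have Ac: "continuous_on UNIV A" unfolding A_def by (rule continuous_p_flux[OF p du])
  have uc: "continuous_on T u" for T using GDERIV_continuous[OF du(1)] .
  obtain dD where dD: "\<And>x. GDERIV (\<lambda>x. det (g x)) x :> dD x" "continuous_on UNIV dD"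
    using C_k_gradient[of 0 "\<lambda>x. det (g x)"] C_k_det[of "Suc 0"] by metis
  define dS where "dS x = (inverse (S x) / 2) *\<^sub>R dD x" for x
  have dS: "GDERIV S x :> dS x" for x
    unfolding S_def [abs_def] dS_def using GDERIV_DERIV_compose[OF dD(1) DERIV_real_sqrt[OF det_pos]] .
  have dSc: "continuous_on UNIV dS" unfolding dS_def
    using S by (intro continuous_intros Sc dD(2)) (simp_all add: less_imp_neq[symmetric])

  define z where "z x = u x - c - \<tau> * f (norm x)" for x
  define dz where "dz x = du x - \<tau> *\<^sub>R (k (norm x) *\<^sub>R sgn x)" for x
  have dz: "GDERIV z x :> dz x" for x
  proof -
    have "GDERIV (\<lambda>x. \<tau> * f (norm x)) x :> \<tau> *\<^sub>R (k (norm x) *\<^sub>R sgn x)"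
      using GDERIV_mult[OF GDERIV_const GDERIV_radial[OF f(1) R f(5) f(4)], of \<tau> x] by simp
    from GDERIV_diff[OF GDERIV_diff[OF du(1) GDERIV_const] this]
    show ?thesis by (simp add: z_def [abs_def] dz_def)
  qed
  have dzc: "continuous_on UNIV dz"
    unfolding dz_def by (intro continuous_intros du(2) continuous_radial_gradient[OF f(2) R f(4)])
  define w where "w x = (if norm x < \<rho> then pos_sq (z x) else 0)" for x
  define dw where "dw x = (if norm x < \<rho> then (2 * max 0 (z x)) *\<^sub>R dz x else 0)" for x
  have neg: "norm x = \<rho> \<Longrightarrow> z x < 0" for x using \<rho>(2)[of x] by (simp add: z_def)
  have dw: "GDERIV w x :> dw x" "continuous_on UNIV dw" for x
    using pos_sq_cutoff[OF dz dzc neg] unfolding w_def [abs_def] dw_def [abs_def] by auto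
  have wc: "continuous_on T w" for T using GDERIV_continuous[OF dw(1)] .
  have supp: "w x = 0" if "norm x > \<rho>" for x using that by (simp add: w_def)
  have dw0: "dw x = 0" if "norm x > \<rho>" for x using that by (simp add: dw_def)
  have w_nonneg: "w x \<ge> 0" for x by (simp add: w_def pos_sq_nonneg)

  \<comment> \<open>The field \<open>a x *\<^sub>R x\<close> is the p-flux of \<tau> f times the
    volume density; the power of \<tau> is the homogeneity of the flux.\<close>
  define a where "a x = \<tau> powr (p - 1) * (Q (norm x) * S x)" for x
  define da where "da x = \<tau> powr (p - 1) *\<^sub>R (Q (norm x) *\<^sub>R dS x + S x *\<^sub>R (Q' (norm x) *\<^sub>R sgn x))" for x
  have da: "GDERIV a x :> da x" for x
    using GDERIV_mult[OF GDERIV_const GDERIV_mult[OF GDERIV_radial[OF Q(1) R Q(3,4)] dS], of "\<tau> powr (p - 1)" x]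
    unfolding a_def [abs_def] da_def by simp
  have Qc: "continuous_on UNIV Q" using Q(1)
    by (intro DERIV_continuous_on[of UNIV]) (blast intro: has_field_derivative_at_within)
  have dac: "continuous_on UNIV da"
    unfolding da_def by (intro continuous_intros dSc Sc continuous_radial_gradient[OF Q(2) R Q(4)]
        continuous_on_compose2[OF Qc]) auto
  have ac: "continuous_on T a" for T using GDERIV_continuous[OF da] .

  \<comment> \<open>The left side is the Euclidean divergence of \<open>a x *\<^sub>R x\<close>,
    with 2 the dimension. Since r * log_deriv is 1 plus the radial derivative of ln (det g) / 2
    times r, it is the density times \<tau>^(p-1) times the expression bounded in
    \<open>div\<close>.\<close>
  have divb: "x \<bullet> da x + 2 * a x \<le> \<tau> powr (p - 1) * (\<beta> * (indicator (cball 0 (R + 1)) x * S x))" for x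
  proof (cases "norm x < R")
    case True
    then have "da x = 0" "a x = 0" using Q(3,4) by (simp_all add: da_def a_def)
    then show ?thesis using Q(6) S[of x] by simp
  next
    case False
    define r where "r = norm x"
    have r: "r \<ge> R" using False by (simp add: r_def)
    have r0: "r > 0" using r R by linarith
    obtain \<theta> where \<theta>: "x = r *\<^sub>R dir \<theta>" using polar_cases unfolding r_def .
    have fD: "frechet_derivative (\<lambda>x. det (g x)) (at x) h = h \<bullet> dD x" for h
      using frechet_derivative_at[OF dD(1)[unfolded gderiv_def]] by metis
    have S2: "det (g x) = S x * S x" using det_pos[of x] by (simp add: S_def)
    have L: "r * log_deriv \<theta> r = 1 + x \<bullet> dD x / (2 * det (g x))"
    proof -
      have "log_deriv \<theta> r = 1 / r + dir \<theta> \<bullet> dD x / (2 * det (g x))"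
        unfolding log_deriv_def \<theta>[symmetric] fD ..
      moreover have "x \<bullet> dD x = r * (dir \<theta> \<bullet> dD x)" by (subst \<theta>) simp
      ultimately show ?thesis using r0 by (simp add: algebra_simps)
    qed
    have xs: "x \<bullet> sgn x = r" using r0 by (simp add: sgn_div_norm r_def dot_square_norm power2_eq_square)
    have "x \<bullet> da x + 2 * a x = \<tau> powr (p - 1) * (S x * (r * Q' r + Q r * (x \<bullet> dD x / (2 * det (g x)) + 2)))"
      unfolding S2 using S[of x]
      by (simp add: da_def a_def dS_def inner_add_right xs r_def[symmetric] field_simps)
    also have "\<dots> = \<tau> powr (p - 1) * (S x * (r * Q' r + Q r * (r * log_deriv \<theta> r + 1)))"
      unfolding L by simp
    also have "\<dots> \<le> \<tau> powr (p - 1) * (S x * (if r \<le> R + 1 then \<beta> else 0))"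
      using S[of x] div[OF r] by (intro mult_left_mono) auto
    also have "\<dots> = \<tau> powr (p - 1) * (\<beta> * (indicator (cball 0 (R + 1)) x * S x))"
      by (simp add: r_def indicator_def)
    finally show ?thesis .
  qed

  have point: "indicator (cball 0 R) x * (S x * (2 * max 0 (u x - c)) * (A x \<bullet> du x))
      \<le> (S x *\<^sub>R A x) \<bullet> dw x - a x * (x \<bullet> dw x)" for x
  proof (cases "norm x \<le> R")
    case True
    then have "z x = u x - c" "a x = 0" "dz x = du x" using f(4,5) Q(3)
      by (simp_all add: z_def a_def dz_def)
    then show ?thesis using True \<rho>(1) by (simp add: dw_def)
  next
    case False
    then have x0: "x \<noteq> 0" using R by auto
    have "(S x *\<^sub>R A x) \<bullet> dw x - a x * (x \<bullet> dw x) \<ge> 0"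
    proof (cases "norm x < \<rho>")
      case True
      define r where "r = norm x"
      have r: "r > 0" using x0 by (simp add: r_def)
      have flux: "(\<tau> * k r) powr (p - 1) *\<^sub>R sgn x = (\<tau> powr (p - 1) * Q r) *\<^sub>R x"
      proof -
        have "(\<tau> * k r) powr (p - 1) = \<tau> powr (p - 1) * (r * Q r)"
          using lam f(3)[of r] by (simp add: powr_mult Q(5))
        then show ?thesis using r by (simp add: sgn_div_norm r_def)
      qed
      have "(A x - (\<tau> * k r) powr (p - 1) *\<^sub>R sgn x) \<bullet> (du x - (\<tau> * k r) *\<^sub>R sgn x) \<ge> 0"
        using p_flux_monotone[OF p x0, of "\<tau> * k r" "riem_grad g u x"] lam f(3)[of r]
        by (simp add: A_def p_flux_def metric_mult_riem_grad[OF du(1)])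
      then have "(A x - (\<tau> powr (p - 1) * Q r) *\<^sub>R x) \<bullet> dz x \<ge> 0"
        unfolding flux by (simp add: dz_def r_def)
      then have "S x * (2 * max 0 (z x)) * ((A x - (\<tau> powr (p - 1) * Q r) *\<^sub>R x) \<bullet> dz x) \<ge> 0"
        using S[of x] by (intro mult_nonneg_nonneg) auto
      also have "\<dots> = (S x *\<^sub>R A x) \<bullet> dw x - a x * (x \<bullet> dw x)"
        using True by (simp add: dw_def a_def r_def inner_diff_left algebra_simps)
      finally show ?thesis .
    qed (simp add: dw_def)
    then show ?thesis using False by simp
  qed

  have i1: "integrable lborel (\<lambda>x. (S x *\<^sub>R A x) \<bullet> dw x)"
    by (rule compact_support_integrable[of _ \<rho>]) (auto intro!: continuous_intros Sc Ac dw simp: dw0)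
  have i2: "integrable lborel (\<lambda>x. a x * (x \<bullet> dw x))"
    by (rule compact_support_integrable[of _ \<rho>]) (auto intro!: continuous_intros ac dw simp: dw0)
  have i3: "integrable lborel (\<lambda>x. w x * (x \<bullet> da x + DIM(real^2) * a x))"
    by (rule compact_support_integrable[of _ \<rho>]) (auto intro!: continuous_intros ac wc dac simp: supp)
  have ind: "integrable lborel (\<lambda>x::real^2. indicator (cball 0 T) x * h x)" if "continuous_on UNIV h" for T and h :: "real^2 \<Rightarrow> real"
    using borel_integrable_compact[of "cball 0 T" h] continuous_on_subset[OF that] by auto
  have "(\<integral>x. indicator (cball 0 R) x * (S x * (2 * max 0 (u x - c)) * (A x \<bullet> du x)) \<partial>lborel)
      \<le> (\<integral>x. (S x *\<^sub>R A x) \<bullet> dw x - a x * (x \<bullet> dw x) \<partial>lborel)"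
    by (intro integral_mono ind Bochner_Integration.integrable_diff i1 i2 point continuous_intros Sc Ac uc du)
  also have "\<dots> = (\<integral>x. (S x *\<^sub>R A x) \<bullet> dw x \<partial>lborel) - (\<integral>x. a x * (x \<bullet> dw x) \<partial>lborel)"
    by (rule Bochner_Integration.integral_diff[OF i1 i2])
  also have "\<dots> \<le> - (\<integral>x. a x * (x \<bullet> dw x) \<partial>lborel)"
    using p_subharmonic_C1_test[OF p du sub dw(1) dw(2) supp w_nonneg] by (simp add: S_def A_def)
  also have "\<dots> = (\<integral>x. w x * (x \<bullet> da x + DIM(real^2) * a x) \<partial>lborel)"
    using integral_radial_by_parts[OF da dac dw(1) dw(2) supp] by simp
  also have "\<dots> \<le> (\<integral>x. \<tau> powr (p - 1) * (\<beta> * (indicator (cball 0 (R + 1)) x * (S x * pos_sq (u x - c)))) \<partial>lborel)"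
  proof (rule integral_mono[OF i3])
    show "integrable lborel (\<lambda>x. \<tau> powr (p - 1) * (\<beta> * (indicator (cball 0 (R + 1)) x * (S x * pos_sq (u x - c)))))"
      by (intro integrable_mult_right ind continuous_intros Sc continuous_pos_sq uc)
    fix x
    \<comment> \<open>Dropping \<tau> f \<ge> 0 makes the remaining integral independent of \<tau>
      and \<rho>.\<close>
    have "w x \<le> pos_sq (u x - c)"
      using lam f(6)[of "norm x"] by (auto simp: w_def z_def pos_sq_nonneg intro!: pos_sq_mono)
    have "w x * (x \<bullet> da x + DIM(real^2) * a x)
        \<le> w x * (\<tau> powr (p - 1) * (\<beta> * (indicator (cball 0 (R + 1)) x * S x)))"
      using divb[of x] w_nonneg[of x] by (intro mult_left_mono) auto
    also have "\<dots> \<le> pos_sq (u x - c) * (\<tau> powr (p - 1) * (\<beta> * (indicator (cball 0 (R + 1)) x * S x)))"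
      using \<open>w x \<le> pos_sq (u x - c)\<close> S[of x] Q(6) by (intro mult_right_mono) auto
    finally show "w x * (x \<bullet> da x + DIM(real^2) * a x)
        \<le> \<tau> powr (p - 1) * (\<beta> * (indicator (cball 0 (R + 1)) x * (S x * pos_sq (u x - c))))"
      by (simp add: ac_simps)
  qed
  finally show ?thesis by (simp add: S_def A_def)
qed

text \<open>Riccati comparison runs along each ray separately, with a constant determined by the
  initial value at radius R. Continuity on the compact circle of that radius makes the constant
  uniform in \<theta>.\<close>

lemma barrier_bound:
  assumes p: "p \<ge> 2"
    and K: "\<And>\<theta> r. r \<ge> R \<Longrightarrow> polar_curvature g \<theta> r \<ge> - ((p - 1) / (r\<^sup>2 * ln r)) \<or>
      polar_curvature g \<theta> r \<ge> - ((p - 1) * (p - 2) / r\<^sup>2)"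
    and R: "R \<ge> exp 1"
  obtains C where "C \<ge> 0"
    "\<And>\<theta> r. r \<ge> R \<Longrightarrow> r\<^sup>2 * (log_deriv \<theta> r - (p - 1) * (1 / r + 1 / (r * ln r))) \<le> C"
proof -
  define h where "h r = (p - 1) * (1 / r + 1 / (r * ln r))" for r
  have R0: "R > 0" using R by (smt (verit) exp_gt_zero)
  obtain dD where dD: "\<And>x. GDERIV (\<lambda>x. det (g x)) x :> dD x" "continuous_on UNIV dD"
    using C_k_gradient[of 0 "\<lambda>x. det (g x)"] C_k_det[of "Suc 0"] by metis
  define B where "B x = 1 / R + (sgn x \<bullet> dD x) / (2 * det (g x))" for x
  have "continuous_on (sphere 0 R) B"
    unfolding B_def sgn_div_norm using det_pos R0
    by (intro continuous_intros continuous_det continuous_on_subset[OF dD(2)]) (auto simp: less_imp_neq[symmetric])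
  then have "bdd_above (B ` sphere 0 R)"
    by (intro bounded_imp_bdd_above compact_imp_bounded compact_continuous_image compact_sphere)
  then obtain M where "\<forall>y\<in>B ` sphere 0 R. y \<le> M" unfolding bdd_above_def by blast
  then have M: "\<And>x. x \<in> sphere 0 R \<Longrightarrow> B x \<le> M" by blast
  have ld: "log_deriv \<theta> R \<le> M" for \<theta>
  proof -
    have "sgn (R *\<^sub>R dir \<theta>) = dir \<theta>" using R0 by (simp add: sgn_div_norm norm_dir)
    moreover have "frechet_derivative (\<lambda>x. det (g x)) (at x) v = v \<bullet> dD x" for x v
      using frechet_derivative_at[OF dD(1)[unfolded gderiv_def]] by metis
    ultimately have "log_deriv \<theta> R = B (R *\<^sub>R dir \<theta>)" by (simp add: log_deriv_def B_def)
    also have "\<dots> \<le> M" using R0 by (intro M) (simp add: norm_dir)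
    finally show ?thesis .
  qed
  show thesis
  proof (rule that)
    show "max (R\<^sup>2 * (M - h R)) 0 \<ge> 0" by simp
    fix \<theta> r assume r: "r \<ge> R"
    have "r\<^sup>2 * (log_deriv \<theta> r - h r) \<le> max (R\<^sup>2 * (log_deriv \<theta> R - h R)) 0"
      unfolding h_def
      by (rule riccati_comparison[OF p R r log_deriv_riccati K]) (use R0 in auto)
    also have "\<dots> \<le> max (R\<^sup>2 * (M - h R)) 0"
      using ld[of \<theta>] by (intro max.mono mult_left_mono) auto
    finally show "r\<^sup>2 * (log_deriv \<theta> r - (p - 1) * (1 / r + 1 / (r * ln r))) \<le> max (R\<^sup>2 * (M - h R)) 0"
      by (simp add: h_def)
  qed
qed

text \<open>The pairing is |grad u|^(p-2) |grad u|^2, and \<open>powr\<close> vanishes only at base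
  0.\<close>

lemma p_flux_inner_gradient:
  assumes "GDERIV u x :> d"
  shows "p_flux p u x \<bullet> d \<ge> 0" "p_flux p u x \<bullet> d = 0 \<Longrightarrow> d = 0"
proof -
  have e: "p_flux p u x \<bullet> d = riem_norm g x (riem_grad g u x) powr (p - 2) * (riem_norm g x (riem_grad g u x))\<^sup>2"
    using metric_mult_riem_grad[OF assms] by (simp add: p_flux_def riem_norm_squared)
  show "p_flux p u x \<bullet> d \<ge> 0" unfolding e by simp
  assume "p_flux p u x \<bullet> d = 0"
  then have "riem_grad g u x = 0" unfolding e by (simp add: riem_norm_eq_0_iff)
  then show "d = 0" using metric_mult_riem_grad[OF assms] by simp
qed

end

section \<open>From the energy bound to constancy\<close>

lemma le_max_modulus:
  assumes "continuous_on UNIV u"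
  shows "\<bar>u x\<bar> \<le> max_modulus u (norm x)"
proof -
  obtain \<theta> where \<theta>: "x = norm x *\<^sub>R dir \<theta>" using polar_cases .
  \<comment> \<open>Boundedness on the circle is what gives the real-valued \<open>SUP\<close> its
    meaning.\<close>
  have "bdd_above ((\<lambda>x. \<bar>u x\<bar>) ` sphere 0 (norm x))"
    by (intro bounded_imp_bdd_above compact_imp_bounded compact_continuous_image compact_sphere
        continuous_intros continuous_on_subset[OF assms]) auto
  moreover have "range (\<lambda>\<theta>. \<bar>u (polar (vector [\<theta>, norm x]))\<bar>) \<subseteq> (\<lambda>x. \<bar>u x\<bar>) ` sphere 0 (norm x)"
    by (auto simp: polar_eq norm_dir intro!: imageI)
  ultimately have "bdd_above (range (\<lambda>\<theta>. \<bar>u (polar (vector [\<theta>, norm x]))\<bar>))"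
    by (rule bdd_above_mono)
  from cSUP_upper[OF UNIV_I this, of \<theta>] show ?thesis
    using \<theta> by (simp add: max_modulus_def polar_eq)
qed

lemma growth_sequence:
  assumes "Liminf at_top (\<lambda>r. ereal (M r / ln (ln r))) = 0" and "\<epsilon> > 0"
  obtains r where "r \<ge> T" "ln (ln r) \<ge> T" "M r < \<epsilon> * ln (ln r)"
proof -
  have ll: "filterlim (\<lambda>r::real. ln (ln r)) at_top at_top"
    by (rule filterlim_compose[OF ln_at_top ln_at_top])
  \<comment> \<open>The 1 keeps ln (ln r) positive, so that the quotient can be cleared at the
    end.\<close>
  have "eventually (\<lambda>r::real. ln (ln r) \<ge> max T 1) at_top"
    using ll unfolding filterlim_at_top by blast
  then have ev: "eventually (\<lambda>r::real. r \<ge> T \<and> ln (ln r) \<ge> max T 1) at_top"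
    by (intro eventually_conj eventually_ge_at_top)
  have "\<not> eventually (\<lambda>r. ereal \<epsilon> \<le> ereal (M r / ln (ln r))) at_top"
  proof
    assume "eventually (\<lambda>r. ereal \<epsilon> \<le> ereal (M r / ln (ln r))) at_top"
    then have "ereal \<epsilon> \<le> 0" using Liminf_bounded[of "ereal \<epsilon>"] assms(1) by metis
    then show False using assms(2) by simp
  qed
  then have "frequently (\<lambda>r. M r / ln (ln r) < \<epsilon>) at_top"
    by (simp add: frequently_def not_less)
  from frequently_eventually_conj[OF this ev] obtain r where
    "M r / ln (ln r) < \<epsilon>" "r \<ge> T" "ln (ln r) \<ge> max T 1"
    by (auto dest: frequently_ex)
  then show thesis using that[of r] by (simp add: field_simps)
qed

text \<open>The points of the open ball at which e is nonzero form an open null set, hence an empty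
  one.\<close>

lemma integral_ball_zero_imp_zero:
  fixes e :: "'a::euclidean_space \<Rightarrow> real"
  assumes e: "continuous_on UNIV e" "\<And>x. x \<in> cball 0 R \<Longrightarrow> e x \<ge> 0"
    and le: "(\<integral>x. indicator (cball 0 R) x * e x \<partial>lborel) \<le> 0" and x: "norm x < R"
  shows "e x = 0"
proof (rule ccontr)
  assume nz: "e x \<noteq> 0"
  have int: "integrable lborel (\<lambda>x. indicator (cball 0 R) x * e x)"
    using borel_integrable_compact[of "cball 0 R" e] continuous_on_subset[OF e(1)] by auto
  have nn: "indicator (cball 0 R) x * e x \<ge> 0" for x
    using e(2)[of x] by (simp add: indicator_def)
  have "(\<integral>x. indicator (cball 0 R) x * e x \<partial>lborel) = 0"
    using le Bochner_Integration.integral_nonneg[of lborel, OF nn] by (rule antisym)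
  then have "AE x in lborel. indicator (cball 0 R) x * e x = 0"
    using integral_nonneg_eq_0_iff_AE[OF int] nn by auto
  then have ae: "AE x in lborel. \<not> (x \<in> ball 0 R \<and> e x \<noteq> 0)"
    by (rule AE_mp) (auto simp: indicator_def)
  define U where "U = {x. x \<in> ball 0 R \<and> e x \<noteq> 0}"
  have "U = ball 0 R \<inter> {x. e x \<noteq> 0}" by (auto simp: U_def)
  moreover have "open {x. e x \<noteq> 0}" by (intro open_Collect_neq e(1) continuous_intros)
  ultimately have "open U" by auto
  moreover have "U \<noteq> {}" using x nz by (auto simp: U_def)
  ultimately have "\<not> negligible U" by (rule open_not_negligible)
  moreover have "U \<in> null_sets lborel"
    using ae AE_iff_null_sets[of U lborel] \<open>open U\<close> by (simp add: U_def)
  then have "negligible U"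
    using negligible_iff_null_sets null_sets_completionI by blast
  ultimately show False by blast
qed

context polar_metric_on_plane
begin

theorem p_subharmonic_Liouville:
  assumes p: "p \<ge> 2" and C1: "C_k 1 u" and sub: "p_subharmonic g p u"
    and K: "\<And>\<theta> r. r \<ge> R1 \<Longrightarrow> polar_curvature g \<theta> r \<ge> - ((p - 1) / (r\<^sup>2 * ln r)) \<or>
      polar_curvature g \<theta> r \<ge> - ((p - 1) * (p - 2) / r\<^sup>2)"
    and R1: "R1 \<ge> exp 1"
    and growth: "Liminf at_top (\<lambda>r. ereal (max_modulus u r / ln (ln r))) = 0"
  shows "u constant_on UNIV"
proof -
  obtain du where du: "\<And>x. GDERIV u x :> du x" "continuous_on UNIV du"
    using C_k_gradient[of 0 u] C1 by (metis One_nat_def)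
  have uc: "continuous_on T u" for T using GDERIV_continuous[OF du(1)] .
  obtain C where C: "C \<ge> 0"
    "\<And>\<theta> r. r \<ge> R1 \<Longrightarrow> r\<^sup>2 * (log_deriv \<theta> r - (p - 1) * (1 / r + 1 / (r * ln r))) \<le> C"
    using barrier_bound[OF p K R1] by blast
  have "du x = 0" for x
  proof -
    define R where "R = max R1 (norm x + 1)"
    have R: "R \<ge> exp 1" "R \<ge> R1" "norm x < R" using R1 by (auto simp: R_def)
    have R0: "R > 0" using R(1) exp_gt_zero[of 1] by linarith
    obtain f k Q Q' :: "real \<Rightarrow> real" and \<beta> where
      f: "\<And>r. (f has_real_derivative k r) (at r)" "continuous_on UNIV k" "\<And>r. k r \<ge> 0"
        "\<And>r. r \<le> R \<Longrightarrow> k r = 0" "\<And>r. r \<le> R \<Longrightarrow> f r = 0" "\<And>r. f r \<ge> 0"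
      and f_ge: "\<And>r. r \<ge> R + 1 \<Longrightarrow> f r \<ge> ln (ln r) - ln (ln (R + 1))"
      and Q: "\<And>r. (Q has_real_derivative Q' r) (at r)" "continuous_on UNIV Q'"
        "\<And>r. r \<le> R \<Longrightarrow> Q r = 0" "\<And>r. r \<le> R \<Longrightarrow> Q' r = 0"
        "\<And>r. r * Q r = k r powr (p - 1)" "\<beta> \<ge> 0"
      and div: "\<And>r \<psi>. r \<ge> R \<Longrightarrow> r\<^sup>2 * (\<psi> - (p - 1) * (1 / r + 1 / (r * ln r))) \<le> C \<Longrightarrow>
        r * Q' r + Q r * (r * \<psi> + 1) \<le> (if r \<le> R + 1 then \<beta> else 0)"
      by (rule radial_barrier[OF p C(1) R(1)]) (rule that)
    have div': "r * Q' r + Q r * (r * log_deriv \<theta> r + 1) \<le> (if r \<le> R + 1 then \<beta> else 0)" if "r \<ge> R" for r \<theta>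
      using that R C(2) by (intro div) auto
    have "bounded (u ` cball 0 R)"
      by (intro compact_imp_bounded compact_continuous_image uc compact_cball)
    then obtain b where "\<forall>v\<in>u ` cball 0 R. norm v \<le> b" unfolding bounded_iff by blast
    then have b: "\<And>y. y \<in> cball 0 R \<Longrightarrow> \<bar>u y\<bar> \<le> b" by auto
    \<comment> \<open>This makes u - c at least 1 on the ball, so the weight in the energy integral
      cannot vanish there.\<close>
    define c where "c = - b - 1"
    have c: "u y - c \<ge> 1" if "y \<in> cball 0 R" for y using b[OF that] by (auto simp: c_def)
    define e where "e y = sqrt (det (g y)) * (2 * max 0 (u y - c)) * (p_flux p u y \<bullet> du y)" for y
    define I where "I = (\<integral>y. indicator (cball 0 R) y * e y \<partial>lborel)"
    define N where "N = \<beta> * (\<integral>y. indicator (cball 0 (R + 1)) y * (sqrt (det (g y)) * pos_sq (u y - c)) \<partial>lborel)"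
    have N: "N \<ge> 0" unfolding N_def using Q(6) det_pos
      by (intro mult_nonneg_nonneg Bochner_Integration.integral_nonneg)
        (auto simp: pos_sq_nonneg less_imp_le)
    have bound: "I \<le> \<tau> powr (p - 1) * N" if \<tau>: "\<tau> > 0" for \<tau>
    proof -
      \<comment> \<open>The entries put the circle beyond the collar, make f \<rho> at least half of
        ln (ln \<rho>), and make |c| at most \<tau> / 4 times ln (ln \<rho>). With |u| below the
        same quarter on the circle, u - c - \<tau> f is negative there.\<close>
      define T where "T = max (R + 2) (max (2 * ln (ln (R + 1))) (\<bar>c\<bar> / (\<tau> / 4)))"
      obtain \<rho> where \<rho>: "\<rho> \<ge> T" "ln (ln \<rho>) \<ge> T" "max_modulus u \<rho> < \<tau> / 4 * ln (ln \<rho>)"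
        using growth_sequence[OF growth, of "\<tau> / 4"] \<tau> by auto
      have L: "ln (ln (R + 1)) \<le> ln (ln \<rho>) / 2" "\<bar>c\<bar> \<le> \<tau> / 4 * ln (ln \<rho>)" "\<rho> \<ge> R + 2"
      proof -
        show "ln (ln (R + 1)) \<le> ln (ln \<rho>) / 2" using \<rho>(2) by (simp add: T_def)
        have "\<bar>c\<bar> / (\<tau> / 4) \<le> ln (ln \<rho>)" using \<rho>(2) by (simp add: T_def)
        then show "\<bar>c\<bar> \<le> \<tau> / 4 * ln (ln \<rho>)" using \<tau> by (simp add: field_simps)
        show "\<rho> \<ge> R + 2" using \<rho>(1) by (simp add: T_def)
      qed
      have "f \<rho> \<ge> ln (ln \<rho>) / 2" using f_ge[of \<rho>] L by simp
      then have "\<tau> * f \<rho> \<ge> \<tau> * (ln (ln \<rho>) / 2)" using \<tau> by (intro mult_left_mono) auto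
      then have bd: "u y - c - \<tau> * f \<rho> < 0" if "norm y = \<rho>" for y
        using le_max_modulus[OF uc, of y] that \<rho>(3) L(2) by (simp add: algebra_simps)
      have "R + 1 < \<rho>" using L(3) by simp
      from energy_bound[OF p du sub R0 f Q div' \<tau> this bd]
      show ?thesis unfolding I_def e_def N_def by simp
    qed
    have "I \<le> 0"
    proof (rule field_le_epsilon)
      fix \<delta> :: real assume \<delta>: "\<delta> > 0"
      define q where "q = \<delta> / (N + 1)"
      \<comment> \<open>The limit \<tau> to 0 is made explicit: this \<tau> turns the bound into
        \<delta> N / (N + 1).\<close>
      define \<tau> where "\<tau> = q powr (1 / (p - 1))"
      have "q > 0" using \<delta> N by (simp add: q_def)
      then have \<tau>: "\<tau> > 0" "\<tau> powr (p - 1) = q"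
        using p by (simp_all add: \<tau>_def powr_powr)
      have "I \<le> \<delta> / (N + 1) * N" using bound[OF \<tau>(1)] \<tau>(2) by (simp add: q_def)
      also have "\<dots> \<le> \<delta>" using \<delta> N by (simp add: field_simps)
      finally show "I \<le> 0 + \<delta>" by simp
    qed
    have e_cont: "continuous_on UNIV e"
      unfolding e_def by (intro continuous_intros continuous_det uc continuous_p_flux[OF p du] du(2))
    have e_nonneg: "e y \<ge> 0" for y
      using det_pos[of y] p_flux_inner_gradient(1)[OF du(1)] by (simp add: e_def)
    have "e x = 0"
      using integral_ball_zero_imp_zero[OF e_cont e_nonneg _ R(3)] \<open>I \<le> 0\<close> by (simp add: I_def)
    then have "p_flux p u x \<bullet> du x = 0"
      using c[of x] R(3) det_pos[of x] by (simp add: e_def)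
    then show ?thesis by (rule p_flux_inner_gradient(2)[OF du(1)])
  qed
  then have "\<exists>a. \<forall>x\<in>UNIV. u x = a"
    using du(1) by (intro has_derivative_zero_constant) (auto simp: gderiv_def)
  then show ?thesis by (simp add: constant_on_def)
qed

end

theorem theorem4:
  fixes g :: "real^2 \<Rightarrow> real^2^2"
    and \<phi> :: "real \<Rightarrow> real \<Rightarrow> real"
    and p :: real
    and u :: "real^2 \<Rightarrow> real"
  assumes "complete_riemannian_metric g"
    and "\<And>\<theta> r. r > 0 \<Longrightarrow> \<phi> \<theta> r > 0"
    and "has_polar_form g \<phi>"
    and "p \<ge> 2"
    and "(\<exists>C. compact C \<and> (\<forall>\<theta> r. r > 0 \<and> polar (vector [\<theta>, r]) \<notin> C \<longrightarrow>
            polar_curvature g \<theta> r \<ge> - ((p - 1) / (r\<^sup>2 * ln r)))) \<or>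
         (\<exists>C. compact C \<and> (\<forall>\<theta> r. r > 0 \<and> polar (vector [\<theta>, r]) \<notin> C \<longrightarrow>
            polar_curvature g \<theta> r \<ge> - ((p - 1) * (p - 2) / r\<^sup>2)))"
    and "C_k 1 u"
    and "p_subharmonic g p u"
    and "Liminf at_top (\<lambda>r. ereal (max_modulus u r / ln (ln r))) = 0"
  shows "u constant_on UNIV"
proof -
  interpret polar_metric_on_plane g \<phi>
    using assms(1,3) by unfold_locales (auto simp: complete_riemannian_metric_def)
  \<comment> \<open>Either curvature hypothesis implies the pointwise disjunction, so both cases run
    through one argument.\<close>
  obtain C where C: "compact C" "\<And>\<theta> r. r > 0 \<Longrightarrow> polar (vector [\<theta>, r]) \<notin> C \<Longrightarrow>
      polar_curvature g \<theta> r \<ge> - ((p - 1) / (r\<^sup>2 * ln r)) \<or>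
      polar_curvature g \<theta> r \<ge> - ((p - 1) * (p - 2) / r\<^sup>2)"
    using assms(5) by blast
  obtain b where b: "\<And>x. x \<in> C \<Longrightarrow> norm x \<le> b"
    using compact_imp_bounded[OF C(1)] by (auto simp: bounded_iff)
  show ?thesis
  proof (rule p_subharmonic_Liouville[OF assms(4,6,7) _ _ assms(8)])
    \<comment> \<open>The entry b + 1 leaves the compact set, and exp 1 ensures ln r \<ge>
      1.\<close>
    show "max (exp 1) (b + 1) \<ge> exp 1" by simp
    fix \<theta> r assume r: "r \<ge> max (exp 1) (b + 1)"
    have r0: "r > 0" using r exp_gt_zero[of 1] by linarith
    have "polar (vector [\<theta>, r]) \<notin> C"
      using b[of "r *\<^sub>R dir \<theta>"] r r0 by (auto simp: polar_eq norm_dir)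
    then show "polar_curvature g \<theta> r \<ge> - ((p - 1) / (r\<^sup>2 * ln r)) \<or>
        polar_curvature g \<theta> r \<ge> - ((p - 1) * (p - 2) / r\<^sup>2)"
      by (rule C(2)[OF r0])
  qed
qed

end
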